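(* Let $E$ be a Banach lattice. The following are equivalent: (a) For every bounded linear operator $T \colon E \longrightarrow \ell_\infty$, the second adjoint $T^{**} \colon E^{**} \longrightarrow \ell_\infty^{**}$ is almost Dunford-Pettis. (b) For every regular linear operator $T \colon E \longrightarrow \ell_\infty$, $T^{**}$ is almost Dunford-Pettis. (c) For every positive linear operator $T \colon E \longrightarrow \ell_\infty$, $T^{**}$ is almost Dunford-Pettis. (d) $E^{**}$ has the positive Schur property.
   Context: Operators are linear; $\ell_\infty$ is the Banach lattice of bounded real sequences with the sup norm and coordinatewise order. An operator between Banach lattices is regular if it is the difference of two positive operators. An operator from a Banach lattice to a Banach space is almost Dunford-Pettis if it sends disjoint weakly null sequences to norm null sequences (equivalently, if it sends positive disjoint weakly null sequences to norm null sequences). A Banach lattice has the positive Schur property if every weakly null sequence of positive elements in it is norm null (equivalently, every disjoint, or every positive disjoint, weakly null sequence is norm null). Duals and biduals of Banach lattices carry their natural Banach lattice structure. *)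

theory Defs
  imports "HOL-Analysis.Analysis" "HOL-Library.Lattice_Algebras"
begin

section \<open>Banach lattices\<close>

class banach_lattice = banach + ordered_real_vector + lattice_ab_group_add_abs +
  assumes norm_le_of_abs_le: "\<bar>x\<bar> \<le> \<bar>y\<bar> \<Longrightarrow> norm x \<le> norm y"

instance real :: banach_lattice
  by standard simp

lemma norm_abs_eq: "norm \<bar>x\<bar> = norm x" for x :: "'a::banach_lattice"
  by (intro order.antisym norm_le_of_abs_le) simp_all

lemma norm_mono_nonneg: "0 \<le> x \<Longrightarrow> x \<le> y \<Longrightarrow> norm x \<le> norm y" for x y :: "'a::banach_lattice"
  by (rule norm_le_of_abs_le) (auto dest: order_trans)

lemma abs_diff_abs_le: "norm (\<bar>x\<bar> - \<bar>y\<bar>) \<le> norm (x - y)" for x y :: "'a::banach_lattice"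
proof (rule norm_le_of_abs_le)
  have 1: "\<bar>x\<bar> \<le> \<bar>x - y\<bar> + \<bar>y\<bar>"
    using abs_triangle_ineq[of "x - y" y] by simp
  have 2: "\<bar>y\<bar> \<le> \<bar>x - y\<bar> + \<bar>x\<bar>"
    using abs_triangle_ineq[of "y - x" x] by (simp add: abs_minus_commute)
  show "\<bar>\<bar>x\<bar> - \<bar>y\<bar>\<bar> \<le> \<bar>x - y\<bar>"
    using 1 2 by (intro abs_leI) (simp_all add: diff_le_eq)
qed

lemma tendsto_abs_lattice:
  fixes f :: "'i \<Rightarrow> 'a::banach_lattice"
  assumes "(f \<longlongrightarrow> l) F"
  shows "((\<lambda>x. \<bar>f x\<bar>) \<longlongrightarrow> \<bar>l\<bar>) F"
proof (rule tendstoI)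
  fix e :: real assume "0 < e"
  from tendstoD[OF assms this] show "\<forall>\<^sub>F x in F. dist \<bar>f x\<bar> \<bar>l\<bar> < e"
    by eventually_elim (metis abs_diff_abs_le dist_norm order_le_less_trans)
qed

lemma double_half: "(1/2::real) *\<^sub>R (x + x) = x" for x :: "'a::real_vector"
  by (simp flip: scaleR_2)

lemma sup_eq_abs: "sup x y = (1/2::real) *\<^sub>R (x + y + \<bar>x - y\<bar>)" for x y :: "'a::banach_lattice"
proof -
  have "x + y + \<bar>x - y\<bar> = sup ((x + y) + (x - y)) ((x + y) + (- (x - y)))"
    unfolding abs_lattice by (simp only: add_sup_distrib_left)
  also have "\<dots> = sup (x + x) (y + y)"
    by (simp add: algebra_simps)
  also have "\<dots> = sup x y + sup x y"
  proof (rule order.antisym)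
    show "sup (x + x) (y + y) \<le> sup x y + sup x y"
      by (intro sup_least add_mono) simp_all
    define z where "z = sup (x + x) (y + y)"
    have z: "x + x \<le> z" "y + y \<le> z" by (simp_all add: z_def)
    have "x \<le> (1/2::real) *\<^sub>R z" "y \<le> (1/2::real) *\<^sub>R z"
      using scaleR_left_mono[OF z(1), of "1/2"] scaleR_left_mono[OF z(2), of "1/2"]
      by (simp_all only: double_half)
    then have "sup x y \<le> (1/2::real) *\<^sub>R z" by simp
    then have "sup x y + sup x y \<le> (1/2::real) *\<^sub>R z + (1/2::real) *\<^sub>R z"
      by (intro add_mono)
    then show "sup x y + sup x y \<le> sup (x + x) (y + y)"
      unfolding z_def[symmetric] by (simp flip: scaleR_left_distrib)
  qed
  finally show ?thesis by (simp only: double_half)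
qed

lemma continuous_on_sup_lattice:
  fixes f g :: "'i::topological_space \<Rightarrow> 'a::banach_lattice"
  assumes "continuous_on S f" "continuous_on S g"
  shows "continuous_on S (\<lambda>x. sup (f x) (g x))"
  using assms unfolding sup_eq_abs continuous_on_def
  by (auto intro!: tendsto_intros tendsto_abs_lattice)

lemma norm_sup_le: "norm (sup x y) \<le> norm x + norm y" for x y :: "'a::banach_lattice"
proof -
  have "norm (sup x y) \<le> (1/2) * (norm (x + y) + norm (x - y))"
    unfolding sup_eq_abs using norm_triangle_ineq[of "x + y" "\<bar>x - y\<bar>"]
    by (simp add: norm_abs_eq)
  also have "\<dots> \<le> norm x + norm y"
    using norm_triangle_ineq[of x y] norm_triangle_ineq4[of x y] by simp
  finally show ?thesis .
qed

lemma lim_nonneg_lattice: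
  fixes f :: "'i \<Rightarrow> 'a::banach_lattice"
  assumes "(f \<longlongrightarrow> l) F" "\<forall>\<^sub>F x in F. 0 \<le> f x" "F \<noteq> bot"
  shows "0 \<le> l"
proof -
  have "((\<lambda>x. \<bar>f x\<bar>) \<longlongrightarrow> l) F"
    using assms(2) by (intro Lim_transform_eventually[OF assms(1)]) (auto elim: eventually_mono)
  from tendsto_unique[OF assms(3) this tendsto_abs_lattice[OF assms(1)]]
  show ?thesis using abs_ge_zero[of l] by (simp del: abs_ge_zero)
qed


section \<open>Operators\<close>

definition positive_operator :: "('a::banach_lattice \<Rightarrow> 'b::banach_lattice) \<Rightarrow> bool" where
  "positive_operator T \<longleftrightarrow> linear T \<and> (\<forall>x\<ge>0. 0 \<le> T x)"

definition regular_operator :: "('a::banach_lattice \<Rightarrow> 'b::banach_lattice) \<Rightarrow> bool" where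
  "regular_operator T \<longleftrightarrow>
    (\<exists>P Q. positive_operator P \<and> positive_operator Q \<and> T = (\<lambda>x. P x - Q x))"

text \<open>Positive, hence regular, operators between Banach lattices are automatically bounded, so that
  turning them into elements of type \<^typ>\<open>'a \<Rightarrow>\<^sub>L 'b\<close> with \<^const>\<open>Blinfun\<close> is meaningful.\<close>

lemma positive_operator_bounded_linear:
  fixes T :: "'a::banach_lattice \<Rightarrow> 'b::banach_lattice"
  assumes "positive_operator T"
  shows "bounded_linear T"
proof -
  have lin: "linear T" and pos: "\<And>x. 0 \<le> x \<Longrightarrow> 0 \<le> T x"
    using assms by (auto simp: positive_operator_def)
  have mono: "T x \<le> T y" if "x \<le> y" for x y
    using pos[of "y - x"] that by (simp add: linear_diff[OF lin])
  have abs: "norm (T x) \<le> norm (T \<bar>x\<bar>)" for x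
  proof (rule norm_le_of_abs_le)
    have "\<bar>T x\<bar> \<le> T \<bar>x\<bar>"
    proof (rule abs_leI)
      show "T x \<le> T \<bar>x\<bar>" by (rule mono) (rule abs_ge_self)
      show "- T x \<le> T \<bar>x\<bar>"
        using mono[of "- x" "\<bar>x\<bar>"] by (simp add: linear_neg[OF lin] abs_ge_minus_self)
    qed
    then show "\<bar>T x\<bar> \<le> \<bar>T \<bar>x\<bar>\<bar>" by (meson abs_ge_self order_trans)
  qed
  have "\<exists>K. \<forall>x. norm (T x) \<le> norm x * K"
  proof (rule ccontr)
    assume "\<not> ?thesis"
    then have "\<forall>n::nat. \<exists>x. norm x * (real n * 2 ^ n) < norm (T x)"
      by (meson not_le)
    then obtain x where x: "\<And>n::nat. norm (x n) * (real n * 2 ^ n) < norm (T (x n))"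
      by metis
    have Tx: "0 < norm (T (x n))" for n
      using x[of n] by (smt (verit) mult_nonneg_nonneg norm_ge_zero of_nat_0_le_iff zero_le_power)
    have nz: "0 < norm (x n)" for n
    proof -
      have "x n \<noteq> 0" using Tx[of n] linear_0[OF lin] by auto
      then show ?thesis by simp
    qed
    define y where "y n = (1 / (norm (x n) * 2 ^ n)) *\<^sub>R \<bar>x n\<bar>" for n
    have y0: "0 \<le> y n" for n
      unfolding y_def by (intro scaleR_nonneg_nonneg) simp_all
    have yn: "norm (y n) = (1/2) ^ n" for n
      using nz[of n] by (simp add: y_def norm_abs_eq power_divide)
    have Ty: "real n \<le> norm (T (y n))" for n
    proof -
      have "norm (T (y n)) = norm (T \<bar>x n\<bar>) / (norm (x n) * 2 ^ n)"
        by (simp add: y_def linear_scale[OF lin])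
      moreover have "real n * (norm (x n) * 2 ^ n) \<le> norm (T \<bar>x n\<bar>)"
        using x[of n] abs[of "x n"] by (simp add: mult_ac)
      ultimately show ?thesis
        using nz[of n] by (simp add: le_divide_eq)
    qed
    have "summable (\<lambda>n. norm (y n))"
      unfolding yn by (rule summable_geometric) simp
    then have sm: "summable y" by (rule summable_norm_cancel)
    have le: "y n \<le> suminf y" for n
    proof -
      have "(\<lambda>m. sum y {..<m} - y n) \<longlonglongrightarrow> suminf y - y n"
        using summable_LIMSEQ[OF sm] by (intro tendsto_intros)
      moreover have "\<forall>\<^sub>F m in sequentially. 0 \<le> sum y {..<m} - y n"
        using eventually_gt_at_top[of n]
      proof eventually_elim
        case (elim m)
        have "sum y {n} \<le> sum y {..<m}"
          using elim y0 by (intro sum_mono2) auto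
        then show ?case by simp
      qed
      ultimately have "0 \<le> suminf y - y n"
        by (rule lim_nonneg_lattice) simp
      then show ?thesis by simp
    qed
    have "real n \<le> norm (T (suminf y))" for n
      using Ty[of n] norm_mono_nonneg[OF pos[OF y0[of n]] mono[OF le[of n]]] by linarith
    moreover obtain n where "norm (T (suminf y)) < real n"
      using reals_Archimedean2 by blast
    ultimately show False by (meson not_le)
  qed
  then obtain K where "\<And>x. norm (T x) \<le> norm x * K" by blast
  then show ?thesis
    using lin by (intro bounded_linear_intro[of T K]) (auto simp: linear_add linear_scale)
qed

lemma regular_operator_bounded_linear: "regular_operator T \<Longrightarrow> bounded_linear T"
  unfolding regular_operator_def
  by (auto dest!: positive_operator_bounded_linear intro: bounded_linear_sub)


section \<open>The space of bounded sequences\<close>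

text \<open>Every function on the discrete space \<^typ>\<open>nat\<close> is continuous, so this is the space of all
  bounded sequences; the norm of \<^type>\<open>bcontfun\<close> is the sup norm.\<close>

type_synonym ell_infty = "nat \<Rightarrow>\<^sub>C real"

text \<open>The library states completeness for a metric space as domain only, which excludes \<^typ>\<open>nat\<close>.\<close>

instance bcontfun :: (topological_space, complete_space) complete_space
proof
  fix f :: "nat \<Rightarrow> 'a \<Rightarrow>\<^sub>C 'b"
  assume "Cauchy f"
  then obtain g where "uniform_limit UNIV f g sequentially"
    using uniformly_convergent_eq_cauchy[of "\<lambda>_. True" f]
    unfolding Cauchy_def uniform_limit_sequentially_iff
    by (metis dist_fun_lt_imp_dist_val_lt)
  from uniform_limit_bcontfunE[OF this sequentially_bot]
  obtain l' where "f \<longlonglongrightarrow> l'" by metis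
  then show "convergent f" by (rule convergentI)
qed

instance bcontfun :: (topological_space, banach) banach ..

instantiation bcontfun :: (topological_space, banach_lattice) ordered_real_vector
begin

definition less_eq_bcontfun :: "('a \<Rightarrow>\<^sub>C 'b) \<Rightarrow> ('a \<Rightarrow>\<^sub>C 'b) \<Rightarrow> bool" where
  "(f :: 'a \<Rightarrow>\<^sub>C 'b) \<le> g \<longleftrightarrow> (\<forall>x. apply_bcontfun f x \<le> apply_bcontfun g x)"

definition less_bcontfun :: "('a \<Rightarrow>\<^sub>C 'b) \<Rightarrow> ('a \<Rightarrow>\<^sub>C 'b) \<Rightarrow> bool" where
  "(f :: 'a \<Rightarrow>\<^sub>C 'b) < g \<longleftrightarrow> f \<le> g \<and> \<not> g \<le> f"

instance
proof
  fix f g h :: "'a \<Rightarrow>\<^sub>C 'b" and a b :: real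
  show "f < g \<longleftrightarrow> f \<le> g \<and> \<not> g \<le> f" by (rule less_bcontfun_def)
  show "f \<le> f" by (simp add: less_eq_bcontfun_def)
  show "f \<le> g \<Longrightarrow> g \<le> h \<Longrightarrow> f \<le> h" unfolding less_eq_bcontfun_def by (meson order_trans)
  show "f \<le> g \<Longrightarrow> g \<le> f \<Longrightarrow> f = g"
    unfolding less_eq_bcontfun_def by (blast intro: bcontfun_eqI order.antisym)
  show "f \<le> g \<Longrightarrow> h + f \<le> h + g" by (simp add: less_eq_bcontfun_def)
  show "f \<le> g \<Longrightarrow> 0 \<le> a \<Longrightarrow> a *\<^sub>R f \<le> a *\<^sub>R g"
    by (simp add: less_eq_bcontfun_def scaleR_left_mono)
  show "a \<le> b \<Longrightarrow> 0 \<le> f \<Longrightarrow> a *\<^sub>R f \<le> b *\<^sub>R f"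
    by (simp add: less_eq_bcontfun_def scaleR_right_mono)
qed

end

instantiation bcontfun :: (topological_space, banach_lattice) banach_lattice
begin

definition sup_bcontfun :: "('a \<Rightarrow>\<^sub>C 'b) \<Rightarrow> ('a \<Rightarrow>\<^sub>C 'b) \<Rightarrow> ('a \<Rightarrow>\<^sub>C 'b)" where
  "sup (f :: 'a \<Rightarrow>\<^sub>C 'b) g = Bcontfun (\<lambda>x. sup (apply_bcontfun f x) (apply_bcontfun g x))"

definition inf_bcontfun :: "('a \<Rightarrow>\<^sub>C 'b) \<Rightarrow> ('a \<Rightarrow>\<^sub>C 'b) \<Rightarrow> ('a \<Rightarrow>\<^sub>C 'b)" where
  "inf (f :: 'a \<Rightarrow>\<^sub>C 'b) g = - sup (- f) (- g)"

definition abs_bcontfun :: "('a \<Rightarrow>\<^sub>C 'b) \<Rightarrow> ('a \<Rightarrow>\<^sub>C 'b)" where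
  "\<bar>f :: 'a \<Rightarrow>\<^sub>C 'b\<bar> = sup f (- f)"

lemma sup_bcontfun_apply:
  "apply_bcontfun (sup f g) x = sup (apply_bcontfun f x) (apply_bcontfun g x)"
  for f g :: "'a \<Rightarrow>\<^sub>C 'b"
proof -
  have "(\<lambda>x. sup (apply_bcontfun f x) (apply_bcontfun g x)) \<in> bcontfun"
  proof (rule bcontfun_normI)
    show "continuous_on UNIV (\<lambda>x. sup (apply_bcontfun f x) (apply_bcontfun g x))"
      by (intro continuous_on_sup_lattice) simp_all
    show "norm (sup (apply_bcontfun f x) (apply_bcontfun g x)) \<le> norm f + norm g" for x
      by (rule order_trans[OF norm_sup_le]) (intro add_mono norm_bounded)
  qed
  then show ?thesis by (simp add: sup_bcontfun_def Bcontfun_inverse)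
qed

lemma inf_bcontfun_apply:
  "apply_bcontfun (inf f g) x = inf (apply_bcontfun f x) (apply_bcontfun g x)"
  for f g :: "'a \<Rightarrow>\<^sub>C 'b"
  by (simp only: inf_bcontfun_def uminus_bcontfun.rep_eq sup_bcontfun_apply
      inf_eq_neg_sup[of "apply_bcontfun f x"])

lemma abs_bcontfun_apply: "apply_bcontfun \<bar>f\<bar> x = \<bar>apply_bcontfun f x\<bar>"
  for f :: "'a \<Rightarrow>\<^sub>C 'b"
  by (simp add: abs_bcontfun_def sup_bcontfun_apply abs_lattice)

instance
proof
  fix f g h :: "'a \<Rightarrow>\<^sub>C 'b"
  show "inf f g \<le> f" "inf f g \<le> g" "f \<le> sup f g" "g \<le> sup f g"
    by (simp_all only: less_eq_bcontfun_def inf_bcontfun_apply sup_bcontfun_apply) simp_all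
  show "f \<le> g \<Longrightarrow> f \<le> h \<Longrightarrow> f \<le> inf g h"
    by (simp add: less_eq_bcontfun_def inf_bcontfun_apply)
  show "g \<le> f \<Longrightarrow> h \<le> f \<Longrightarrow> sup g h \<le> f"
    by (simp add: less_eq_bcontfun_def sup_bcontfun_apply)
  show "\<bar>f\<bar> = sup f (- f)" by (rule abs_bcontfun_def)
  assume "\<bar>f\<bar> \<le> \<bar>g\<bar>"
  then have "norm (apply_bcontfun f x) \<le> norm (apply_bcontfun g x)" for x
    unfolding less_eq_bcontfun_def abs_bcontfun_apply by (intro norm_le_of_abs_le) blast
  then show "norm f \<le> norm g"
    by (intro norm_bound) (meson norm_bounded order_trans)
qed

end


section \<open>The dual Banach lattice\<close>

text \<open>The dual space is \<^typ>\<open>'a \<Rightarrow>\<^sub>L real\<close>. A type class instance for \<^type>\<open>blinfun\<close> can constrain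
  the codomain only by a type class, so the following class stands for the ordered normed
  space of real numbers (the condition says that \<open>to_real\<close> is an isometric order isomorphism).\<close>

class real_line = banach_lattice +
  fixes to_real :: "'a \<Rightarrow> real"
  assumes to_real_add: "to_real (x + y) = to_real x + to_real y"
    and to_real_scaleR: "to_real (c *\<^sub>R x) = c * to_real x"
    and to_real_le_iff: "to_real x \<le> to_real y \<longleftrightarrow> x \<le> y"
    and abs_to_real: "\<bar>to_real x\<bar> = norm x"
    and surj_to_real: "surj to_real"

instantiation real :: real_line
begin

definition to_real_real :: "real \<Rightarrow> real" where "to_real_real x = x"

instance
  by standard (auto simp: to_real_real_def surj_def)

end

instantiation blinfun :: (banach_lattice, banach_lattice) ordered_real_vector
begin

definition less_eq_blinfun :: "('a \<Rightarrow>\<^sub>L 'b) \<Rightarrow> ('a \<Rightarrow>\<^sub>L 'b) \<Rightarrow> bool" where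
  "(f :: 'a \<Rightarrow>\<^sub>L 'b) \<le> g \<longleftrightarrow> (\<forall>x\<ge>0. blinfun_apply f x \<le> blinfun_apply g x)"

definition less_blinfun :: "('a \<Rightarrow>\<^sub>L 'b) \<Rightarrow> ('a \<Rightarrow>\<^sub>L 'b) \<Rightarrow> bool" where
  "(f :: 'a \<Rightarrow>\<^sub>L 'b) < g \<longleftrightarrow> f \<le> g \<and> \<not> g \<le> f"

instance
proof
  fix f g h :: "'a \<Rightarrow>\<^sub>L 'b" and a b :: real
  show "f < g \<longleftrightarrow> f \<le> g \<and> \<not> g \<le> f" by (rule less_blinfun_def)
  show "f \<le> f" by (simp add: less_eq_blinfun_def)
  show "f \<le> g \<Longrightarrow> g \<le> h \<Longrightarrow> f \<le> h" unfolding less_eq_blinfun_def by (meson order_trans)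
  show "f = g" if "f \<le> g" "g \<le> f"
  proof (rule blinfun_eqI)
    fix x :: 'a
    have eq: "blinfun_apply f y = blinfun_apply g y" if "0 \<le> y" for y
      using \<open>f \<le> g\<close> \<open>g \<le> f\<close> that unfolding less_eq_blinfun_def by (intro order.antisym) auto
    have "blinfun_apply f (pprt x) - blinfun_apply f (- nprt x) =
        blinfun_apply g (pprt x) - blinfun_apply g (- nprt x)"
      using eq[of "pprt x"] eq[of "- nprt x"] by simp
    then show "blinfun_apply f x = blinfun_apply g x"
      by (simp add: prts[of x, symmetric] flip: blinfun.diff_right)
  qed
  show "f \<le> g \<Longrightarrow> h + f \<le> h + g" by (simp add: less_eq_blinfun_def blinfun.add_left)
  show "f \<le> g \<Longrightarrow> 0 \<le> a \<Longrightarrow> a *\<^sub>R f \<le> a *\<^sub>R g"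
    by (simp add: less_eq_blinfun_def scaleR_left_mono blinfun.scaleR_left)
  show "a \<le> b \<Longrightarrow> 0 \<le> f \<Longrightarrow> a *\<^sub>R f \<le> b *\<^sub>R f"
    by (simp add: less_eq_blinfun_def scaleR_right_mono blinfun.scaleR_left)
qed

end

lemma riesz_decomposition:
  fixes x y z :: "'a::banach_lattice"
  assumes "0 \<le> x" "0 \<le> y" "0 \<le> z" "z \<le> x + y"
  obtains z1 z2 where "z = z1 + z2" "0 \<le> z1" "z1 \<le> x" "0 \<le> z2" "z2 \<le> y"
proof
  show "z = inf z x + (z - inf z x)" by (simp del: diff_inf_eq_sup)
  show "0 \<le> inf z x" "inf z x \<le> x" "0 \<le> z - inf z x" using assms by (simp_all del: diff_inf_eq_sup)
  have "z - y \<le> inf z x" using assms by (simp add: diff_le_eq)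
  then show "z - inf z x \<le> y" by (metis add.commute diff_le_eq)
qed

text \<open>The Riesz--Kantorovich construction of the positive part of a functional.\<close>

lemma riesz_kantorovich:
  fixes u :: "'a::banach_lattice \<Rightarrow> real"
  assumes u: "bounded_linear u"
  obtains h :: "'a \<Rightarrow> real" where "bounded_linear h" "\<And>x. 0 \<le> x \<Longrightarrow> h x = (SUP y\<in>{0..x}. u y)"
proof -
  interpret u: bounded_linear u by (rule u)
  obtain K where K: "\<And>x. \<bar>u x\<bar> \<le> norm x * K" "0 \<le> K"
    using u.nonneg_bounded by auto
  define p where "p x = (SUP y\<in>{0..x}. u y)" for x
  have uK: "u y \<le> norm x * K" if "y \<in> {0..x}" for x y
  proof -
    have "norm y * K \<le> norm x * K"
      using that K(2) by (intro mult_right_mono norm_mono_nonneg) auto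
    then show ?thesis using K(1)[of y] by linarith
  qed
  have bdd: "bdd_above (u ` {0..x})" for x
    using uK by (intro bdd_aboveI2[where M = "norm x * K"]) blast
  have upper: "u y \<le> p x" if "0 \<le> y" "y \<le> x" for x y
    unfolding p_def using that by (intro cSUP_upper bdd) auto
  have least: "p x \<le> c" if "0 \<le> x" "\<And>y. 0 \<le> y \<Longrightarrow> y \<le> x \<Longrightarrow> u y \<le> c" for x c
    unfolding p_def using that by (intro cSUP_least) auto
  have p0: "0 \<le> p x" if "0 \<le> x" for x
    using upper[of 0 x] that by (simp add: u.zero)
  have pK: "p x \<le> norm x * K" if "0 \<le> x" for x
    using that uK by (intro least) auto
  have padd: "p (x + y) = p x + p y" if xy: "0 \<le> x" "0 \<le> y" for x y
  proof (rule order.antisym)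
    show "p (x + y) \<le> p x + p y"
    proof (rule least)
      show "0 \<le> x + y" using xy by simp
      fix z assume "0 \<le> z" "z \<le> x + y"
      with xy obtain z1 z2 where "z = z1 + z2" "0 \<le> z1" "z1 \<le> x" "0 \<le> z2" "z2 \<le> y"
        by (rule riesz_decomposition)
      then show "u z \<le> p x + p y" by (auto simp: u.add intro!: add_mono upper)
    qed
    have "p x \<le> p (x + y) - p y"
    proof (rule least[OF xy(1)])
      fix v assume v: "0 \<le> v" "v \<le> x"
      have "p y \<le> p (x + y) - u v"
      proof (rule least[OF xy(2)])
        fix w assume "0 \<le> w" "w \<le> y"
        then have "u (v + w) \<le> p (x + y)" using v by (intro upper add_mono add_nonneg_nonneg)
        then show "u w \<le> p (x + y) - u v" by (simp add: u.add)
      qed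
      then show "u v \<le> p (x + y) - p y" by simp
    qed
    then show "p x + p y \<le> p (x + y)" by simp
  qed
  have pscale_le: "p (c *\<^sub>R x) \<le> c * p x" if "0 < c" "0 \<le> x" for c x
  proof (rule least)
    show "0 \<le> c *\<^sub>R x" using that by (simp add: scaleR_nonneg_nonneg)
    fix y assume y: "0 \<le> y" "y \<le> c *\<^sub>R x"
    have "inverse c *\<^sub>R y \<le> inverse c *\<^sub>R (c *\<^sub>R x)"
      using that y by (intro scaleR_left_mono) auto
    then have "u (inverse c *\<^sub>R y) \<le> p x"
      using that y by (intro upper) (auto simp: scaleR_nonneg_nonneg)
    then show "u y \<le> c * p x" using that by (simp add: u.scaleR field_simps)
  qed
  have p_zero: "p 0 = 0" using padd[of 0 0] by simp
  have pscale: "p (c *\<^sub>R x) = c * p x" if "0 \<le> c" "0 \<le> x" for c x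
  proof (cases "c = 0")
    case False
    with that have c: "0 < c" by simp
    have "p (inverse c *\<^sub>R (c *\<^sub>R x)) \<le> inverse c * p (c *\<^sub>R x)"
      using c that by (intro pscale_le) (auto simp: scaleR_nonneg_nonneg)
    then have "c * p x \<le> p (c *\<^sub>R x)" using c by (simp add: field_simps)
    with pscale_le[OF c that(2)] show ?thesis by simp
  qed (simp add: p_zero)
  define h where "h x = p (pprt x) - p (- nprt x)" for x
  have h_diff: "h (x - y) = p x - p y" if xy: "0 \<le> x" "0 \<le> y" for x y
  proof -
    have "pprt (x - y) + y = x + - nprt (x - y)"
      using prts[of "x - y"] by (simp add: algebra_simps)
    then have "p (pprt (x - y)) + p y = p x + p (- nprt (x - y))"
      using xy padd by (metis neg_0_le_iff_le nprt_le_zero zero_le_pprt)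
    then show ?thesis by (simp add: h_def)
  qed
  have dec: "x = pprt x - (- nprt x)" "0 \<le> pprt x" "0 \<le> - nprt x" for x :: 'a
    using prts[of x] by simp_all
  have hp: "h x = p x" if "0 \<le> x" for x
    using h_diff[of x 0] that by (simp add: p_zero)
  have hadd: "h (x + y) = h x + h y" for x y
  proof -
    have "(pprt x + pprt y) - (- nprt x + - nprt y) = (pprt x + nprt x) + (pprt y + nprt y)"
      by (simp add: algebra_simps)
    then have "x + y = (pprt x + pprt y) - (- nprt x + - nprt y)"
      by (simp only: prts[symmetric])
    then have "h (x + y) = p (pprt x + pprt y) - p (- nprt x + - nprt y)"
      using h_diff dec by (metis add_nonneg_nonneg)
    also have "\<dots> = h x + h y"
      using padd[OF dec(2)[of x] dec(2)[of y]] padd[OF dec(3)[of x] dec(3)[of y]]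
      by (simp add: h_def)
    finally show ?thesis .
  qed
  have hneg: "h (- x) = - h x" for x
    using hadd[of x "- x"] hp[of 0] p_zero by simp
  have hscale0: "h (c *\<^sub>R x) = c * h x" if c: "0 \<le> c" for c x
  proof -
    have "c *\<^sub>R x = c *\<^sub>R pprt x - c *\<^sub>R (- nprt x)"
      by (metis dec(1) scaleR_right_diff_distrib)
    moreover have "0 \<le> c *\<^sub>R pprt x" "0 \<le> c *\<^sub>R (- nprt x)"
      using c dec by (intro scaleR_nonneg_nonneg; simp)+
    ultimately have "h (c *\<^sub>R x) = p (c *\<^sub>R pprt x) - p (c *\<^sub>R (- nprt x))"
      using h_diff by metis
    also have "\<dots> = c * h x"
      using pscale[OF c dec(2)[of x]] pscale[OF c dec(3)[of x]]
      by (simp add: h_def right_diff_distrib)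
    finally show ?thesis .
  qed
  have hscale: "h (c *\<^sub>R x) = c * h x" for c x
  proof (cases "0 \<le> c")
    case False
    then show ?thesis using hscale0[of "- c" x] hneg[of "c *\<^sub>R x"] by simp
  qed (rule hscale0)
  have "bounded_linear h"
  proof (rule bounded_linear_intro[of h K])
    show "norm (h x) \<le> norm x * K" for x
    proof -
      have "p (pprt x) \<le> norm x * K"
      proof -
        have "norm (pprt x) \<le> norm \<bar>x\<bar>"
          by (rule norm_mono_nonneg) (simp_all add: pprt_def abs_ge_self)
        then show ?thesis
          using pK[of "pprt x"] K(2) by (smt (verit) mult_right_mono norm_abs_eq zero_le_pprt)
      qed
      moreover have "p (- nprt x) \<le> norm x * K"
      proof -
        have "norm (- nprt x) \<le> norm \<bar>x\<bar>"
          by (rule norm_mono_nonneg) (simp_all add: nprt_def abs_ge_minus_self)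
        then show ?thesis
          using pK[of "- nprt x"] K(2) by (smt (verit) mult_right_mono norm_abs_eq dec(3))
      qed
      moreover have "0 \<le> p (pprt x)" "0 \<le> p (- nprt x)" using p0 dec by blast+
      ultimately show ?thesis by (simp add: h_def abs_le_iff)
    qed
  qed (simp_all add: hadd hscale)
  then show ?thesis using that hp unfolding p_def by blast
qed

definition of_real_line :: "real \<Rightarrow> 'a::real_line" where
  "of_real_line = inv to_real"

lemma to_real_of_real_line [simp]: "to_real (of_real_line r) = r"
  unfolding of_real_line_def by (simp add: surj_f_inv_f surj_to_real)

lemma to_real_inject: "to_real x = to_real y \<longleftrightarrow> x = y"
  by (metis order.antisym order.refl to_real_le_iff)

lemma bounded_linear_to_real: "bounded_linear to_real"
  by (rule bounded_linear_intro[where K = 1])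
     (simp_all add: to_real_add to_real_scaleR abs_to_real)

lemma bounded_linear_of_real_line: "bounded_linear of_real_line"
proof (rule bounded_linear_intro[where K = 1])
  fix x y :: real
  show "of_real_line (x + y) = (of_real_line x + of_real_line y :: 'a)"
    by (simp add: to_real_inject[where 'a='a, symmetric] to_real_add)
  show "of_real_line (x *\<^sub>R y) = (x *\<^sub>R of_real_line y :: 'a)"
    by (simp add: to_real_inject[where 'a='a, symmetric] to_real_scaleR)
  show "norm (of_real_line x :: 'a) \<le> norm x * 1"
    by (simp add: abs_to_real[where 'a='a, symmetric])
qed

lemma blinfun_positive_part:
  fixes f :: "'a::banach_lattice \<Rightarrow>\<^sub>L 'b::real_line"
  obtains h :: "'a \<Rightarrow>\<^sub>L 'b"
    where "\<And>x::'a. 0 \<le> x \<Longrightarrow> to_real (blinfun_apply h x) = (SUP y\<in>{0..x}. to_real (blinfun_apply f y))"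
proof -
  have "bounded_linear (\<lambda>x. to_real (blinfun_apply f x))"
    by (intro bounded_linear_compose[OF bounded_linear_to_real] blinfun.bounded_linear_right)
  then obtain p :: "'a \<Rightarrow> real" where p: "bounded_linear p"
      "\<And>x::'a. 0 \<le> x \<Longrightarrow> p x = (SUP y\<in>{0..x}. to_real (blinfun_apply f y))"
    by (rule riesz_kantorovich) blast
  have "bounded_linear (\<lambda>x. of_real_line (p x) :: 'b)"
    by (intro bounded_linear_compose[OF bounded_linear_of_real_line] p)
  then show ?thesis
    using p(2) by (intro that[of "Blinfun (\<lambda>x. of_real_line (p x))"])
      (simp only: bounded_linear_Blinfun_apply to_real_of_real_line)
qed

lemma bdd_above_blinfun_interval:
  fixes f :: "'a::banach_lattice \<Rightarrow>\<^sub>L 'b::real_line"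
  shows "bdd_above ((\<lambda>y. to_real (blinfun_apply f y)) ` {0..x})"
proof (rule bdd_aboveI2)
  fix y assume "y \<in> {0..x}"
  then have "norm y \<le> norm x" by (intro norm_mono_nonneg) auto
  then have "norm f * norm y \<le> norm f * norm x" by (intro mult_left_mono) auto
  then have "norm (blinfun_apply f y) \<le> norm f * norm x"
    using norm_blinfun[of f y] by linarith
  then show "to_real (blinfun_apply f y) \<le> norm f * norm x"
    using abs_to_real[of "blinfun_apply f y"] by linarith
qed

lemma blinfun_ex_sup:
  fixes f g :: "'a::banach_lattice \<Rightarrow>\<^sub>L 'b::real_line"
  obtains h :: "'a \<Rightarrow>\<^sub>L 'b" where "f \<le> h" "g \<le> h" "\<And>k. f \<le> k \<Longrightarrow> g \<le> k \<Longrightarrow> h \<le> k"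
    "\<And>x::'a. 0 \<le> x \<Longrightarrow> to_real (blinfun_apply h x) =
      to_real (blinfun_apply g x) + (SUP y\<in>{0..x}. to_real (blinfun_apply (f - g) y))"
proof -
  obtain p :: "'a \<Rightarrow>\<^sub>L 'b" where p: "\<And>x::'a. 0 \<le> x \<Longrightarrow>
      to_real (blinfun_apply p x) = (SUP y\<in>{0..x}. to_real (blinfun_apply (f - g) y))"
    using blinfun_positive_part[of "f - g"] by blast
  have val: "to_real (blinfun_apply (g + p) x) =
      to_real (blinfun_apply g x) + (SUP y\<in>{0..x}. to_real (blinfun_apply (f - g) y))"
    if "0 \<le> x" for x :: 'a
    using p[OF that] by (simp add: blinfun.add_left to_real_add)
  have up: "to_real (blinfun_apply (f - g) y) \<le> to_real (blinfun_apply p x)"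
    if "0 \<le> y" "y \<le> x" for x y :: 'a
    using p[of x] that cSUP_upper[OF _ bdd_above_blinfun_interval, of y x "f - g"]
    by (auto dest: order_trans)
  have zero: "to_real (0::'b) = 0"
    using abs_to_real[of "0::'b"] by simp
  have diff: "to_real (a - b) = to_real a - to_real b" for a b :: 'b
    using to_real_add[of "a - b" b] by simp
  show ?thesis
  proof (rule that[OF _ _ _ val])
    show "g \<le> g + p"
      using up[of 0] zero
      by (auto simp: less_eq_blinfun_def blinfun.zero_right blinfun.add_left to_real_add
          to_real_le_iff[where 'a='b, symmetric])
    show "f \<le> g + p"
      unfolding less_eq_blinfun_def
    proof safe
      fix x :: 'a assume "0 \<le> x"
      then show "blinfun_apply f x \<le> blinfun_apply (g + p) x"
        using up[of x x]
        by (simp add: blinfun.diff_left blinfun.add_left to_real_add diff to_real_le_iff[where 'a='b, symmetric])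
    qed
    show "g + p \<le> k" if k: "f \<le> k" "g \<le> k" for k
      unfolding less_eq_blinfun_def
    proof safe
      fix x :: 'a assume x: "0 \<le> x"
      have "(SUP y\<in>{0..x}. to_real (blinfun_apply (f - g) y)) \<le>
          to_real (blinfun_apply (k - g) x)"
      proof (rule cSUP_least)
        show "{0..x} \<noteq> {}" using x by auto
        fix y assume y: "y \<in> {0..x}"
        have 1: "blinfun_apply f y \<le> blinfun_apply k y"
          using k y by (simp add: less_eq_blinfun_def)
        have 2: "blinfun_apply g (x - y) \<le> blinfun_apply k (x - y)"
          using k y by (simp add: less_eq_blinfun_def)
        show "to_real (blinfun_apply (f - g) y) \<le> to_real (blinfun_apply (k - g) x)"
          using 1 2
          by (simp add: blinfun.diff_left blinfun.diff_right diff to_real_le_iff[where 'a='b, symmetric])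
      qed
      then show "blinfun_apply (g + p) x \<le> blinfun_apply k x"
        using p[OF x]
        by (simp add: blinfun.diff_left blinfun.add_left to_real_add diff to_real_le_iff[where 'a='b, symmetric])
    qed
  qed
qed

instantiation blinfun :: (banach_lattice, real_line) banach_lattice
begin

definition sup_blinfun :: "('a \<Rightarrow>\<^sub>L 'b) \<Rightarrow> ('a \<Rightarrow>\<^sub>L 'b) \<Rightarrow> ('a \<Rightarrow>\<^sub>L 'b)" where
  "sup (f :: 'a \<Rightarrow>\<^sub>L 'b) g = (THE h. f \<le> h \<and> g \<le> h \<and> (\<forall>k. f \<le> k \<longrightarrow> g \<le> k \<longrightarrow> h \<le> k))"

definition inf_blinfun :: "('a \<Rightarrow>\<^sub>L 'b) \<Rightarrow> ('a \<Rightarrow>\<^sub>L 'b) \<Rightarrow> ('a \<Rightarrow>\<^sub>L 'b)" where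
  "inf (f :: 'a \<Rightarrow>\<^sub>L 'b) g = - sup (- f) (- g)"

definition abs_blinfun :: "('a \<Rightarrow>\<^sub>L 'b) \<Rightarrow> ('a \<Rightarrow>\<^sub>L 'b)" where
  "\<bar>f :: 'a \<Rightarrow>\<^sub>L 'b\<bar> = sup f (- f)"

lemma sup_blinfun_eqI:
  fixes f g h :: "'a \<Rightarrow>\<^sub>L 'b"
  assumes "f \<le> h" "g \<le> h" "\<And>k. f \<le> k \<Longrightarrow> g \<le> k \<Longrightarrow> h \<le> k"
  shows "sup f g = h"
  unfolding sup_blinfun_def using assms by (intro the_equality) (auto intro: order.antisym)

lemma sup_blinfun_bounds:
  fixes f g :: "'a \<Rightarrow>\<^sub>L 'b"
  shows "f \<le> sup f g" "g \<le> sup f g" "f \<le> k \<Longrightarrow> g \<le> k \<Longrightarrow> sup f g \<le> k"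
  by (rule blinfun_ex_sup[of f g], metis sup_blinfun_eqI)+

lemma sup_blinfun_apply:
  fixes f g :: "'a \<Rightarrow>\<^sub>L 'b" and x :: 'a
  assumes "0 \<le> x"
  shows "to_real (blinfun_apply (sup f g) x) =
    to_real (blinfun_apply g x) + (SUP y\<in>{0..x}. to_real (blinfun_apply (f - g) y))"
  by (rule blinfun_ex_sup[of f g]) (metis assms sup_blinfun_eqI)

lemma abs_blinfun_apply_le:
  fixes f :: "'a \<Rightarrow>\<^sub>L 'b" and x :: 'a
  assumes x: "0 \<le> x"
  shows "to_real (blinfun_apply \<bar>f\<bar> x) \<le> norm f * norm x"
proof -
  have neg: "to_real (- a) = - to_real a" for a :: 'b
    using to_real_scaleR[of "-1" a] by simp
  have "(SUP y\<in>{0..x}. to_real (blinfun_apply (f - - f) y)) \<le>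
      norm f * norm x + to_real (blinfun_apply f x)"
  proof (rule cSUP_least)
    show "{0..x} \<noteq> {}" using x by auto
    fix y assume y: "y \<in> {0..x}"
    have "norm (y + y - x) \<le> norm x"
    proof (rule norm_le_of_abs_le)
      have "y + y \<le> x + x" using y by (intro add_mono) auto
      moreover have "0 \<le> y + y" using y by simp
      ultimately have "\<bar>y + y - x\<bar> \<le> x"
        by (intro abs_leI) (simp_all add: diff_le_eq)
      then show "\<bar>y + y - x\<bar> \<le> \<bar>x\<bar>" using x by simp
    qed
    then have "norm f * norm (y + y - x) \<le> norm f * norm x" by (intro mult_left_mono) auto
    then have "norm (blinfun_apply f (y + y - x)) \<le> norm f * norm x"
      using norm_blinfun[of f "y + y - x"] by linarith
    then have "to_real (blinfun_apply f (y + y - x)) \<le> norm f * norm x"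
      using abs_to_real[of "blinfun_apply f (y + y - x)"] by linarith
    then show "to_real (blinfun_apply (f - - f) y) \<le> norm f * norm x + to_real (blinfun_apply f x)"
      using to_real_add[of "blinfun_apply f (y + y - x)" "blinfun_apply f x"]
      by (simp add: blinfun.diff_right blinfun.add_right blinfun.diff_left blinfun.add_left)
  qed
  then show ?thesis
    unfolding abs_blinfun_def by (simp add: sup_blinfun_apply[OF x] blinfun.minus_left neg)
qed

instance
proof
  fix f g h :: "'a \<Rightarrow>\<^sub>L 'b"
  show "f \<le> sup f g" "g \<le> sup f g" by (rule sup_blinfun_bounds)+
  show "g \<le> f \<Longrightarrow> h \<le> f \<Longrightarrow> sup g h \<le> f" by (rule sup_blinfun_bounds)
  show "inf f g \<le> f"
    using sup_blinfun_bounds(1)[of "- f" "- g"] unfolding inf_blinfun_def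
    by (metis minus_le_iff)
  show "inf f g \<le> g"
    using sup_blinfun_bounds(2)[of "- g" "- f"] unfolding inf_blinfun_def
    by (metis minus_le_iff)
  show "f \<le> g \<Longrightarrow> f \<le> h \<Longrightarrow> f \<le> inf g h"
    using sup_blinfun_bounds(3)[of "- g" "- f" "- h"] unfolding inf_blinfun_def
    by (metis le_minus_iff neg_le_iff_le)
  show "\<bar>f\<bar> = sup f (- f)" by (rule abs_blinfun_def)
  assume fg: "\<bar>f\<bar> \<le> \<bar>g\<bar>"
  show "norm f \<le> norm g"
  proof (rule norm_blinfun_bound)
    show "0 \<le> norm g" by simp
    fix x :: 'a
    have neg: "to_real (- a) = - to_real a" for a :: 'b
      using to_real_scaleR[of "-1" a] by simp
    have abs: "\<bar>to_real (blinfun_apply f y)\<bar> \<le> to_real (blinfun_apply \<bar>f\<bar> y)" if "0 \<le> y" for y :: 'a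
    proof -
      have "f \<le> \<bar>f\<bar>" "- f \<le> \<bar>f\<bar>" unfolding abs_blinfun_def by (rule sup_blinfun_bounds)+
      then have "blinfun_apply f y \<le> blinfun_apply \<bar>f\<bar> y"
          "- blinfun_apply f y \<le> blinfun_apply \<bar>f\<bar> y"
        using that by (simp_all add: less_eq_blinfun_def blinfun.minus_left)
      then show ?thesis by (simp add: abs_le_iff neg add: to_real_le_iff[where 'a='b, symmetric])
    qed
    have x: "x = pprt x + nprt x" "\<bar>x\<bar> = pprt x + - nprt x"
      using prts[of x] abs_prts[of x] by simp_all
    have "\<bar>to_real (blinfun_apply f x)\<bar> \<le>
        \<bar>to_real (blinfun_apply f (pprt x))\<bar> + \<bar>to_real (blinfun_apply f (- nprt x))\<bar>"
      by (subst x(1)) (simp add: blinfun.add_right to_real_add blinfun.minus_right neg)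
    also have "\<dots> \<le> to_real (blinfun_apply \<bar>f\<bar> (pprt x)) + to_real (blinfun_apply \<bar>f\<bar> (- nprt x))"
      by (intro add_mono abs) simp_all
    also have "\<dots> = to_real (blinfun_apply \<bar>f\<bar> \<bar>x\<bar>)"
      by (simp only: x(2) blinfun.add_right to_real_add)
    also have "\<dots> \<le> to_real (blinfun_apply \<bar>g\<bar> \<bar>x\<bar>)"
      using fg by (simp add: to_real_le_iff less_eq_blinfun_def)
    also have "\<dots> \<le> norm g * norm \<bar>x\<bar>"
      by (rule abs_blinfun_apply_le) simp
    finally show "norm (blinfun_apply f x) \<le> norm g * norm x"
      by (simp add: norm_abs_eq abs_to_real)
  qed
qed

end


section \<open>Adjoints, weakly null sequences and the positive Schur property\<close>

lift_definition adjoint_blinfun ::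
  "('a::real_normed_vector \<Rightarrow>\<^sub>L 'b::real_normed_vector) \<Rightarrow> ('b \<Rightarrow>\<^sub>L real) \<Rightarrow>\<^sub>L ('a \<Rightarrow>\<^sub>L real)"
  is "\<lambda>T g. g o\<^sub>L T"
  by (rule bounded_bilinear.bounded_linear_left[OF bounded_bilinear_blinfun_compose])

abbreviation second_adjoint ::
  "('a::real_normed_vector \<Rightarrow>\<^sub>L 'b::real_normed_vector) \<Rightarrow>
    (('a \<Rightarrow>\<^sub>L real) \<Rightarrow>\<^sub>L real) \<Rightarrow>\<^sub>L (('b \<Rightarrow>\<^sub>L real) \<Rightarrow>\<^sub>L real)" where
  "second_adjoint T \<equiv> adjoint_blinfun (adjoint_blinfun T)"

definition weakly_null :: "(nat \<Rightarrow> 'a::real_normed_vector) \<Rightarrow> bool" where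
  "weakly_null x \<longleftrightarrow> (\<forall>f :: 'a \<Rightarrow>\<^sub>L real. (\<lambda>n. blinfun_apply f (x n)) \<longlonglongrightarrow> 0)"

definition disjoint_sequence :: "(nat \<Rightarrow> 'a::banach_lattice) \<Rightarrow> bool" where
  "disjoint_sequence x \<longleftrightarrow> (\<forall>m n. m \<noteq> n \<longrightarrow> inf \<bar>x m\<bar> \<bar>x n\<bar> = 0)"

definition almost_dunford_pettis :: "('a::banach_lattice \<Rightarrow>\<^sub>L 'b::banach) \<Rightarrow> bool" where
  "almost_dunford_pettis T \<longleftrightarrow>
    (\<forall>x. disjoint_sequence x \<longrightarrow> weakly_null x \<longrightarrow> (\<lambda>n. blinfun_apply T (x n)) \<longlonglongrightarrow> 0)"

definition positive_schur_property :: "'a::banach_lattice itself \<Rightarrow> bool" where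
  "positive_schur_property _ \<longleftrightarrow>
    (\<forall>x :: nat \<Rightarrow> 'a. (\<forall>n. 0 \<le> x n) \<longrightarrow> weakly_null x \<longrightarrow> x \<longlonglongrightarrow> 0)"

end

theory Submission
  imports Defs
begin

text \<open>
  The implications from (a) to (b) and from (b) to (c) are inclusions between classes of operators.
  The other two rest on two facts about disjointness.

  From (d) to (a): a disjoint weakly null sequence \<open>x\<close> in \<open>E**\<close> has weakly null positive and negative
  parts. Indeed, for a positive functional \<open>f\<close> there is a functional that agrees with \<open>f\<close> on the
  ideal generated by all the \<open>x n\<^sup>+\<close> and vanishes on its disjoint complement, so it takes at
  \<open>x n\<close> the value of \<open>f\<close> at \<open>x n\<^sup>+\<close> (lemmas \<open>truncation_functional\<close> and
  \<open>weakly_null_pprt_of_disjoint\<close>). The positive Schur property then makes \<open>x\<close> norm null, and every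
  bounded operator preserves this.

  From (c) to (d): suppose that \<open>x\<close> is positive and weakly null in \<open>E**\<close>, but not norm null. After
  passing to a subsequence there are positive \<open>f n\<close> in the unit ball of \<open>E*\<close> at which \<open>x n\<close> is bounded
  away from zero. Lemma \<open>disjointification\<close> replaces \<open>x\<close> by a disjoint sequence \<open>v\<close> below a subsequence of
  it, hence still weakly null, that is still bounded away from zero at the corresponding functionals.
  If \<open>T\<close> has these functionals as its coordinates, the coordinate functionals of the bounded sequences show
  that the second adjoint of \<open>T\<close> does not send \<open>v\<close> to a norm null sequence.

  What makes a disjointification possible without any order continuity of the norm is that the
  functionals \<open>f n\<close> lie in the predual \<open>E*\<close>: the infimum of a decreasing sequence of positive elements of
  \<open>E**\<close> is its pointwise limit, so infinitely many later terms can be cut off from \<open>x n\<close> at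
  once, with unbounded coefficients, while the loss at \<open>f n\<close> remains under control.
\<close>

section \<open>Inequalities in Banach lattices\<close>

lemma inf_pprt_nprt: "inf (pprt x) (- nprt x) = 0" for x :: "'a::banach_lattice"
proof -
  have "inf (x + - nprt x) (0 + - nprt x) = inf x 0 + - nprt x"
    by (rule add_inf_distrib_right[symmetric])
  moreover have "x + - nprt x = pprt x"
    using prts[of x] by (metis diff_conv_add_uminus add_diff_cancel_right')
  moreover have "inf x 0 + - nprt x = 0"
    by (simp only: nprt_def right_minus)
  ultimately show ?thesis by (simp only: add_0_left)
qed

lemma member_le_sum_nonneg:
  fixes u :: "'i \<Rightarrow> 'a::banach_lattice"
  assumes "\<And>i. 0 \<le> u i" "finite A" "i \<in> A"
  shows "u i \<le> sum u A"
  using sum_mono2[of A "{i}" u] assms by simp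

lemma pprt_le_abs: "pprt x \<le> \<bar>x\<bar>" for x :: "'a::banach_lattice"
  unfolding pprt_def by (simp add: abs_ge_self)

text \<open>
  The first bound is the positive part, the second one at most the negative part, of the same element
  \<open>a - c b\<close>; the second one carries the factor \<open>1/c\<close>, which is at most 1. This lets each of two
  elements be made disjoint from the other by cutting off a large multiple from one of them and only a
  small multiple from the other.
\<close>
lemma inf_pprt_diff_eq_0:
  fixes a b u w :: "'a::banach_lattice"
  assumes c: "1 \<le> c" and u: "0 \<le> u" "u \<le> pprt (a - c *\<^sub>R b)"
    and w: "0 \<le> w" "w \<le> pprt (b - (1 / c) *\<^sub>R a)"
  shows "inf u w = 0"
proof (rule order.antisym)
  define y where "y = a - c *\<^sub>R b"
  have "b - (1 / c) *\<^sub>R a = (1 / c) *\<^sub>R (- y)"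
    using c by (simp add: y_def scaleR_right_diff_distrib)
  also have "\<dots> \<le> (1 / c) *\<^sub>R (- nprt y)"
    using c by (intro scaleR_left_mono) (simp_all add: nprt_def)
  also have "\<dots> \<le> 1 *\<^sub>R (- nprt y)"
    using c by (intro scaleR_right_mono) simp_all
  finally have "pprt (b - (1 / c) *\<^sub>R a) \<le> - nprt y"
    by (simp add: pprt_def)
  then have "inf u w \<le> inf (pprt y) (- nprt y)"
    using u w by (intro inf_mono) (auto simp: y_def)
  then show "inf u w \<le> 0" by (simp only: inf_pprt_nprt)
qed (use u w in simp)

lemma inf_add_le:
  fixes x y w :: "'a::banach_lattice"
  assumes "0 \<le> x" "0 \<le> y" "0 \<le> w"
  shows "inf (x + y) w \<le> inf x w + inf y w"
proof -
  have "inf (x + y) w \<le> x + inf y w"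
    unfolding add_inf_distrib_left using assms by (intro inf_mono) simp_all
  moreover have "inf (x + y) w \<le> w + inf y w"
    using assms by (intro order_trans[OF inf_le2]) simp
  ultimately have "inf (x + y) w \<le> inf (x + inf y w) (w + inf y w)" by simp
  then show ?thesis by (simp only: add_inf_distrib_right)
qed

lemma inf_add_eq_0:
  fixes x y w :: "'a::banach_lattice"
  assumes "0 \<le> x" "0 \<le> y" "0 \<le> w" "inf x w = 0" "inf y w = 0"
  shows "inf (x + y) w = 0"
  using inf_add_le[OF assms(1-3)] assms by (intro order.antisym) simp_all

text \<open>
  This is orthogonality to \<open>N\<close> times a partial sum. The multiple is written as an iterated sum
  because induction on \<open>N\<close> then needs nothing but additivity.
\<close>
lemma inf_iterated_sum_eq_0:
  fixes u :: "nat \<Rightarrow> 'a::banach_lattice"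
  assumes "\<And>n. 0 \<le> u n" "0 \<le> w" "\<And>n. inf (u n) w = 0"
  shows "inf (\<Sum>i<N::nat. sum u {..<k}) w = 0"
proof -
  have "inf (sum u {..<k}) w = 0"
    by (induction k) (use assms in \<open>auto intro!: inf_add_eq_0 sum_nonneg simp: inf_absorb1\<close>)
  then show ?thesis
    by (induction N) (use assms in \<open>auto intro!: inf_add_eq_0 sum_nonneg simp: inf_absorb1\<close>)
qed


section \<open>Positive functionals and weakly null sequences\<close>

lemma blinfun_mono:
  fixes f :: "'a::banach_lattice \<Rightarrow>\<^sub>L real"
  assumes "0 \<le> f" "x \<le> y"
  shows "blinfun_apply f x \<le> blinfun_apply f y"
proof -
  have "0 \<le> blinfun_apply f (y - x)"
    using assms unfolding less_eq_blinfun_def by simp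
  then show ?thesis by (simp add: blinfun.diff_right)
qed

lemma blinfun_nonneg: "0 \<le> f \<Longrightarrow> 0 \<le> x \<Longrightarrow> 0 \<le> blinfun_apply f x"
  for f :: "'a::banach_lattice \<Rightarrow>\<^sub>L real"
  by (simp add: less_eq_blinfun_def)

lemma abs_blinfun_le:
  fixes f :: "'a::banach_lattice \<Rightarrow>\<^sub>L real"
  assumes "0 \<le> x"
  shows "\<bar>blinfun_apply f x\<bar> \<le> blinfun_apply \<bar>f\<bar> x"
proof -
  have "f \<le> \<bar>f\<bar>" "- f \<le> \<bar>f\<bar>" by (rule abs_ge_self, rule abs_ge_minus_self)
  then show ?thesis
    using assms by (auto simp: less_eq_blinfun_def blinfun.minus_left abs_le_iff)
qed

lemma abs_blinfun_apply_le_abs: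
  fixes f :: "'a::banach_lattice \<Rightarrow>\<^sub>L real"
  assumes "0 \<le> f"
  shows "\<bar>blinfun_apply f x\<bar> \<le> blinfun_apply f \<bar>x\<bar>"
  using blinfun_mono[OF assms, of x "\<bar>x\<bar>"] blinfun_mono[OF assms, of "- x" "\<bar>x\<bar>"]
  by (simp add: abs_ge_self abs_ge_minus_self blinfun.minus_right abs_le_iff)

lemma weakly_null_le:
  fixes v x :: "nat \<Rightarrow> 'a::banach_lattice"
  assumes "weakly_null x" "\<And>n. 0 \<le> v n" "\<And>n. v n \<le> x n"
  shows "weakly_null v"
  unfolding weakly_null_def
proof
  fix f :: "'a \<Rightarrow>\<^sub>L real"
  have "(\<lambda>n. blinfun_apply \<bar>f\<bar> (x n)) \<longlonglongrightarrow> 0"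
    using assms(1) by (simp add: weakly_null_def)
  moreover have "norm (blinfun_apply f (v n)) \<le> blinfun_apply \<bar>f\<bar> (x n)" for n
    using abs_blinfun_le[OF assms(2), of f n] blinfun_mono[OF _ assms(3), of "\<bar>f\<bar>" n]
    by simp
  ultimately show "(\<lambda>n. blinfun_apply f (v n)) \<longlonglongrightarrow> 0"
    by (rule Lim_null_comparison[OF always_eventually[OF allI], rotated])
qed

lemma weakly_null_subseq:
  fixes x :: "nat \<Rightarrow> 'a::real_normed_vector"
  assumes "weakly_null x" "strict_mono k"
  shows "weakly_null (x \<circ> k)"
  unfolding weakly_null_def
proof
  fix f :: "'a \<Rightarrow>\<^sub>L real"
  have "(\<lambda>n. blinfun_apply f (x n)) \<longlonglongrightarrow> 0" using assms(1) by (simp add: weakly_null_def)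
  from LIMSEQ_subseq_LIMSEQ[OF this assms(2)]
  show "(\<lambda>n. blinfun_apply f ((x \<circ> k) n)) \<longlonglongrightarrow> 0" by (simp add: o_def)
qed

text \<open>
  A positive functional does not decrease in modulus when its argument is replaced by its absolute
  value, so that its norm is approached on the positive part of the unit ball.
\<close>
lemma blinfun_almost_norming_nonneg:
  fixes x :: "('a::banach_lattice \<Rightarrow>\<^sub>L real)"
  assumes "0 \<le> x" "e < norm x" "0 \<le> e"
  obtains f where "0 \<le> f" "norm f \<le> 1" "e \<le> blinfun_apply x f"
proof -
  have "\<exists>f. e * norm f < \<bar>blinfun_apply x f\<bar>"
  proof (rule ccontr)
    assume "\<not> ?thesis"
    then have "norm x \<le> e" by (intro norm_blinfun_bound[OF assms(3)]) (simp add: not_less)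
    with assms(2) show False by simp
  qed
  then obtain f where f: "e * norm f < \<bar>blinfun_apply x f\<bar>" by blast
  then have "f \<noteq> 0" by (auto simp: blinfun.zero_right)
  then have nf: "0 < norm f" by simp
  have "e * norm f \<le> blinfun_apply x \<bar>f\<bar>"
    using f abs_blinfun_apply_le_abs[OF assms(1), of f] by linarith
  then have "e \<le> blinfun_apply x ((1 / norm f) *\<^sub>R \<bar>f\<bar>)"
    using nf by (simp add: blinfun.scaleR_right field_simps)
  moreover have "0 \<le> (1 / norm f) *\<^sub>R \<bar>f\<bar>" by (intro scaleR_nonneg_nonneg) simp_all
  moreover have "norm ((1 / norm f) *\<^sub>R \<bar>f\<bar>) \<le> 1" using nf by (simp add: norm_abs_eq)
  ultimately show ?thesis using that by blast
qed


section \<open>Splitting off the positive parts of a disjoint sequence\<close>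

text \<open>
  Every element is a difference of positive ones, and additivity makes \<open>p x - p y\<close> depend on \<open>x - y\<close> only.
  Domination by \<open>f\<close> gives the boundedness.
\<close>
lemma additive_on_cone_extension:
  fixes p :: "'a::banach_lattice \<Rightarrow> real" and f :: "'a \<Rightarrow>\<^sub>L real"
  assumes add: "\<And>x y. 0 \<le> x \<Longrightarrow> 0 \<le> y \<Longrightarrow> p (x + y) = p x + p y"
    and scale: "\<And>r x. 0 < r \<Longrightarrow> 0 \<le> x \<Longrightarrow> p (r *\<^sub>R x) = r * p x"
    and nonneg: "\<And>x. 0 \<le> x \<Longrightarrow> 0 \<le> p x"
    and le: "\<And>x. 0 \<le> x \<Longrightarrow> p x \<le> blinfun_apply f x"
  obtains h :: "'a \<Rightarrow>\<^sub>L real"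
    where "\<And>x y. 0 \<le> x \<Longrightarrow> 0 \<le> y \<Longrightarrow> blinfun_apply h (x - y) = p x - p y"
proof -
  define h where "h x = p (pprt x) - p (- nprt x)" for x
  have dec: "x = pprt x - (- nprt x)" "0 \<le> pprt x" "0 \<le> - nprt x" for x :: 'a
    using prts[of x] by simp_all
  have p_zero: "p 0 = 0" using add[of 0 0] by simp
  have h_diff: "h (x - y) = p x - p y" if xy: "0 \<le> x" "0 \<le> y" for x y
  proof -
    have "pprt (x - y) + y = x + - nprt (x - y)"
      using prts[of "x - y"] by (simp add: algebra_simps)
    then have "p (pprt (x - y)) + p y = p x + p (- nprt (x - y))"
      using xy add dec by metis
    then show ?thesis by (simp add: h_def)
  qed
  have h_add: "h (x + y) = h x + h y" for x y
  proof -
    have "x + y = (pprt x + pprt y) - (- nprt x + - nprt y)"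
      using dec(1)[of x] dec(1)[of y] by (metis add_diff_add)
    then have "h (x + y) = p (pprt x + pprt y) - p (- nprt x + - nprt y)"
      using h_diff dec by (metis add_nonneg_nonneg)
    also have "\<dots> = h x + h y"
      using add[OF dec(2)[of x] dec(2)[of y]] add[OF dec(3)[of x] dec(3)[of y]]
      by (simp add: h_def)
    finally show ?thesis .
  qed
  have h_pos: "h (r *\<^sub>R x) = r * h x" if r: "0 < r" for r x
  proof -
    have "r *\<^sub>R x = r *\<^sub>R pprt x - r *\<^sub>R (- nprt x)"
      by (metis dec(1) scaleR_right_diff_distrib)
    moreover have "0 \<le> r *\<^sub>R pprt x" "0 \<le> r *\<^sub>R (- nprt x)"
      using r dec by (intro scaleR_nonneg_nonneg; simp)+
    ultimately show ?thesis
      using h_diff scale[OF r dec(2)[of x]] scale[OF r dec(3)[of x]]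
      by (metis h_def right_diff_distrib)
  qed
  have h_zero: "h 0 = 0" by (simp add: h_def)
  have h_neg: "h (- x) = - h x" for x
    using h_add[of x "- x"] h_zero by simp
  have h_scale: "h (r *\<^sub>R x) = r * h x" for r x
    using h_pos[of r x] h_pos[of "- r" x] h_neg[of "r *\<^sub>R x"] h_zero
    by (cases r "0::real" rule: linorder_cases) simp_all
  have "bounded_linear h"
  proof (rule bounded_linear_intro[of h "norm f"])
    fix x :: 'a
    have "\<bar>h x\<bar> \<le> p (pprt x) + p (- nprt x)"
      using nonneg[OF dec(2)[of x]] nonneg[OF dec(3)[of x]] by (simp add: h_def abs_le_iff)
    also have "\<dots> \<le> blinfun_apply f (pprt x) + blinfun_apply f (- nprt x)"
      by (intro add_mono le dec)
    also have "\<dots> = blinfun_apply f \<bar>x\<bar>"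
      by (simp add: abs_prts blinfun.diff_right blinfun.minus_right)
    also have "\<dots> \<le> norm x * norm f"
      using norm_blinfun[of f "\<bar>x\<bar>"] by (simp add: norm_abs_eq mult.commute)
    finally show "norm (h x) \<le> norm x * norm f" by simp
  qed (simp_all add: h_add h_scale)
  then show ?thesis
    using that[of "Blinfun h"] h_diff by (simp add: bounded_linear_Blinfun_apply)
qed

text \<open>
  The functional is \<open>x \<mapsto> sup\<^sub>k f (inf x (w k))\<close> on the positive cone: the least positive functional
  that agrees with \<open>f\<close> on the ideal generated by the \<open>w k\<close>. It is subadditive by the truncation inequality \<open>inf_add_le\<close>. For
  superadditivity and homogeneity, multiples of \<open>w k\<close> have to be dominated by some \<open>w j\<close>.
\<close>
lemma truncation_functional:
  fixes f :: "'a::banach_lattice \<Rightarrow>\<^sub>L real" and w :: "nat \<Rightarrow> 'a"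
  assumes f: "0 \<le> f" and w: "\<And>k. 0 \<le> w k" "incseq w"
    and absorb: "\<And>r k. \<exists>j. r *\<^sub>R w k \<le> w j"
  obtains h :: "'a \<Rightarrow>\<^sub>L real" where
    "\<And>x y k. 0 \<le> x \<Longrightarrow> x \<le> w k \<Longrightarrow> 0 \<le> y \<Longrightarrow> (\<And>j. inf (w j) y = 0) \<Longrightarrow>
      blinfun_apply h (x - y) = blinfun_apply f x"
proof -
  define p where "p x = (SUP k. blinfun_apply f (inf x (w k)))" for x
  have bdd: "bdd_above (range (\<lambda>k. blinfun_apply f (inf x (w k))))" for x
    by (rule bdd_aboveI2[where M = "blinfun_apply f x"]) (simp add: blinfun_mono[OF f])
  have upper: "blinfun_apply f (inf x (w k)) \<le> p x" for x k
    unfolding p_def by (rule cSUP_upper[OF UNIV_I bdd])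
  have least: "p x \<le> c" if "\<And>k. blinfun_apply f (inf x (w k)) \<le> c" for x c
    unfolding p_def using that by (intro cSUP_least) auto
  have p_add: "p (x + y) = p x + p y" if xy: "0 \<le> x" "0 \<le> y" for x y
  proof (rule order.antisym)
    show "p (x + y) \<le> p x + p y"
    proof (rule least)
      fix k
      have "blinfun_apply f (inf (x + y) (w k)) \<le> blinfun_apply f (inf x (w k) + inf y (w k))"
        by (intro blinfun_mono f inf_add_le xy w)
      also have "\<dots> \<le> p x + p y"
        unfolding blinfun.add_right by (intro add_mono upper)
      finally show "blinfun_apply f (inf (x + y) (w k)) \<le> p x + p y" .
    qed
    have "p x \<le> p (x + y) - p y"
    proof (rule least)
      fix k
      have "p y \<le> p (x + y) - blinfun_apply f (inf x (w k))"
      proof (rule least)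
        fix l
        obtain j where j: "2 *\<^sub>R w (max k l) \<le> w j" using absorb by blast
        have "inf x (w k) + inf y (w l) \<le> w (max k l) + w (max k l)"
          using incseqD[OF w(2), of k "max k l"] incseqD[OF w(2), of l "max k l"]
          by (intro add_mono) (auto intro: le_infI2)
        also have "\<dots> \<le> w j" using j by (simp add: scaleR_2)
        finally have "inf x (w k) + inf y (w l) \<le> inf (x + y) (w j)"
          by (simp add: add_mono)
        from blinfun_mono[OF f this] upper[of "x + y" j]
        show "blinfun_apply f (inf y (w l)) \<le> p (x + y) - blinfun_apply f (inf x (w k))"
          by (simp add: blinfun.add_right)
      qed
      then show "blinfun_apply f (inf x (w k)) \<le> p (x + y) - p y" by simp
    qed
    then show "p x + p y \<le> p (x + y)" by simp
  qed
  have p_scale_le: "p x \<le> (1 / r) * p (r *\<^sub>R x)" if r: "0 < r" for r x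
  proof (rule least)
    fix k
    obtain j where j: "r *\<^sub>R w k \<le> w j" using absorb by blast
    have "r *\<^sub>R inf x (w k) \<le> inf (r *\<^sub>R x) (w j)"
      using r j scaleR_left_mono[of "inf x (w k)" x r] scaleR_left_mono[of "inf x (w k)" "w k" r]
      by (auto intro: order_trans)
    from blinfun_mono[OF f this] upper[of "r *\<^sub>R x" j]
    show "blinfun_apply f (inf x (w k)) \<le> (1 / r) * p (r *\<^sub>R x)"
      using r by (simp add: blinfun.scaleR_right field_simps)
  qed
  have p_scale: "p (r *\<^sub>R x) = r * p x" if r: "0 < r" for r x
    using p_scale_le[OF r, of x] p_scale_le[of "1 / r" "r *\<^sub>R x"] r by (simp add: field_simps)
  have p_nonneg: "0 \<le> p x" if "0 \<le> x" for x
    using upper[of x 0] blinfun_nonneg[OF f, of "inf x (w 0)"] that w(1)[of 0] by simp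
  have p_le: "p x \<le> blinfun_apply f x" for x
    by (intro least blinfun_mono f) simp
  obtain h where h: "\<And>x y. 0 \<le> x \<Longrightarrow> 0 \<le> y \<Longrightarrow> blinfun_apply h (x - y) = p x - p y"
    using additive_on_cone_extension[of p f, OF p_add p_scale p_nonneg p_le] by blast
  show ?thesis
  proof (rule that)
    fix x y k
    assume x: "0 \<le> x" "x \<le> w k" and y: "0 \<le> y" "\<And>j. inf (w j) y = 0"
    have "p y = 0" by (simp add: p_def inf_commute[of y] y(2) blinfun.zero_right)
    moreover have "p x = blinfun_apply f x"
      using p_le[of x] upper[of x k] x(2) by (simp add: inf_absorb1)
    ultimately show "blinfun_apply h (x - y) = blinfun_apply f x"
      by (simp add: h[OF x(1) y(1)])
  qed
qed

text \<open>
  The truncation functional \<open>h\<close> belonging to the multiples of the partial sums of the \<open>x n\<^sup>+\<close> sees all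
  positive parts and, by disjointness, none of the negative parts. Hence \<open>f (x n\<^sup>+) = h (x n)\<close>, for one
  and the same \<open>h\<close>, tends to zero.
\<close>
lemma weakly_null_pprt_of_disjoint:
  fixes x :: "nat \<Rightarrow> 'a::banach_lattice"
  assumes disj: "disjoint_sequence x" and null: "weakly_null x"
  shows "weakly_null (\<lambda>n. pprt (x n))"
  unfolding weakly_null_def
proof
  fix g :: "'a \<Rightarrow>\<^sub>L real"
  define f where "f = \<bar>g\<bar>"
  define s where "s k = (\<Sum>n<k. pprt (x n))" for k
  \<comment> \<open>Multiplying by the index makes the sequence absorb all multiples of its members.\<close>
  define w where "w k = (\<Sum>i<k. s k)" for k :: nat
  have s0: "0 \<le> s k" for k unfolding s_def by (intro sum_nonneg) simp
  have s_mono: "s k \<le> s l" if "k \<le> l" for k l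
    unfolding s_def using that by (intro sum_mono2) auto
  have w_eq: "w k = real k *\<^sub>R s k" for k
    by (simp add: w_def sum_constant_scaleR)
  have w_ge: "r *\<^sub>R s k \<le> w l" if "r \<le> real l" "k \<le> l" for r k l
  proof -
    have "r *\<^sub>R s k \<le> real l *\<^sub>R s k" using that s0 by (intro scaleR_right_mono) auto
    also have "\<dots> \<le> real l *\<^sub>R s l" using that by (intro scaleR_left_mono s_mono) auto
    finally show ?thesis by (simp only: w_eq)
  qed
  have orth: "inf (pprt (x n)) (- nprt (x m)) = 0" for n m
  proof (cases "n = m")
    case False
    have "inf (pprt (x n)) (- nprt (x m)) \<le> inf \<bar>x n\<bar> \<bar>x m\<bar>"
      by (intro inf_mono pprt_le_abs) (simp add: nprt_def abs_ge_minus_self)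
    also have "\<dots> = 0" using disj False by (simp add: disjoint_sequence_def)
    finally show ?thesis by (intro order.antisym) auto
  qed (simp add: inf_pprt_nprt)
  have "0 \<le> f" by (simp add: f_def)
  moreover have "0 \<le> w k" for k unfolding w_def using s0 by (intro sum_nonneg) simp
  moreover have "incseq w"
    by (rule monoI) (simp add: w_eq[of "_::nat"] w_ge[unfolded w_eq])
  moreover have "\<exists>j. r *\<^sub>R w k \<le> w j" for r k
  proof -
    obtain j where j: "r * real k \<le> real j" using real_arch_simple by blast
    have "r *\<^sub>R w k = (r * real k) *\<^sub>R s k" by (simp add: w_eq)
    also have "\<dots> \<le> w (max j k)" using j by (intro w_ge) auto
    finally show ?thesis by blast
  qed
  ultimately obtain h :: "'a \<Rightarrow>\<^sub>L real" where h:
    "\<And>y z k. 0 \<le> y \<Longrightarrow> y \<le> w k \<Longrightarrow> 0 \<le> z \<Longrightarrow> (\<And>j. inf (w j) z = 0) \<Longrightarrow>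
      blinfun_apply h (y - z) = blinfun_apply f y"
    by (rule truncation_functional) blast
  have h_eq: "blinfun_apply h (x m) = blinfun_apply f (pprt (x m))" for m
  proof -
    have "pprt (x m) \<le> s (Suc m)"
      unfolding s_def by (rule member_le_sum_nonneg[of "\<lambda>n. pprt (x n)"]) auto
    then have "pprt (x m) \<le> w (Suc m)"
      using w_ge[of 1 "Suc m" "Suc m"] by simp
    moreover have "inf (w j) (- nprt (x m)) = 0" for j
      unfolding w_def s_def by (rule inf_iterated_sum_eq_0) (simp_all add: orth)
    ultimately have "blinfun_apply h (pprt (x m) - - nprt (x m)) = blinfun_apply f (pprt (x m))"
      by (intro h) simp_all
    then show ?thesis using prts[of "x m"] by simp
  qed
  have "(\<lambda>n. blinfun_apply f (pprt (x n))) \<longlonglongrightarrow> 0"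
    using null by (simp add: weakly_null_def flip: h_eq)
  then show "(\<lambda>n. blinfun_apply g (pprt (x n))) \<longlonglongrightarrow> 0"
    by (rule Lim_null_comparison[rotated]) (simp add: f_def abs_blinfun_le)
qed


section \<open>Disjointification\<close>

text \<open>
  At a positive argument the values decrease and are bounded below; by linearity the pointwise limit
  exists everywhere.
\<close>
lemma decseq_functional_limit:
  fixes v :: "nat \<Rightarrow> 'a::banach_lattice \<Rightarrow>\<^sub>L real"
  assumes dec: "decseq v" and nonneg: "\<And>n. 0 \<le> v n"
  obtains u where "0 \<le> u" "\<And>n. u \<le> v n"
    "\<And>x. (\<lambda>n. blinfun_apply (v n) x) \<longlonglongrightarrow> blinfun_apply u x"
proof -
  have conv_pos: "convergent (\<lambda>n. blinfun_apply (v n) x)" if "0 \<le> x" for x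
  proof (rule Bseq_monoseq_convergent)
    have le: "blinfun_apply (v n) x \<le> blinfun_apply (v m) x" if "m \<le> n" for m n
      using decseqD[OF dec that] \<open>0 \<le> x\<close> by (simp add: less_eq_blinfun_def)
    then show "monoseq (\<lambda>n. blinfun_apply (v n) x)" by (auto simp: monoseq_def)
    show "Bseq (\<lambda>n. blinfun_apply (v n) x)"
      using le[of 0] blinfun_nonneg[OF nonneg \<open>0 \<le> x\<close>]
      by (intro BseqI'[of _ "blinfun_apply (v 0) x"]) simp
  qed
  have conv: "convergent (\<lambda>n. blinfun_apply (v n) x)" for x
  proof -
    have "convergent (\<lambda>n. blinfun_apply (v n) (pprt x) - blinfun_apply (v n) (- nprt x))"
      by (intro convergent_diff conv_pos) simp_all
    moreover have "pprt x - - nprt x = x" using prts[of x] by simp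
    ultimately show ?thesis by (simp only: flip: blinfun.diff_right)
  qed
  define L where "L x = lim (\<lambda>n. blinfun_apply (v n) x)" for x
  have L: "(\<lambda>n. blinfun_apply (v n) x) \<longlonglongrightarrow> L x" for x
    unfolding L_def using conv by (simp add: convergent_LIMSEQ_iff)
  have "bounded_linear L"
  proof (rule bounded_linear_intro[of L "norm (v 0)"])
    fix x y :: 'a and r :: real
    show "L (x + y) = L x + L y"
      using LIMSEQ_unique[OF L[of "x + y"]] tendsto_add[OF L[of x] L[of y]]
      by (simp add: blinfun.add_right)
    show "L (r *\<^sub>R x) = r *\<^sub>R L x"
      using LIMSEQ_unique[OF L[of "r *\<^sub>R x"]] tendsto_scaleR[OF tendsto_const L[of x]]
      by (simp add: blinfun.scaleR_right)
    have "norm (blinfun_apply (v n) x) \<le> norm x * norm (v 0)" for n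
    proof -
      have "norm (v n) \<le> norm (v 0)"
        using nonneg decseqD[OF dec, of 0 n] by (intro norm_mono_nonneg) simp_all
      then have "norm (v n) * norm x \<le> norm (v 0) * norm x" by (intro mult_right_mono) auto
      then show ?thesis using norm_blinfun[of "v n" x] by (simp add: mult.commute)
    qed
    then show "norm (L x) \<le> norm x * norm (v 0)"
      using tendsto_norm[OF L[of x]] by (intro LIMSEQ_le_const2) auto
  qed
  then have app: "blinfun_apply (Blinfun L) = L" by (rule bounded_linear_Blinfun_apply)
  show ?thesis
  proof (rule that)
    show "0 \<le> Blinfun L"
      unfolding less_eq_blinfun_def app
      by (auto simp: blinfun_nonneg nonneg intro!: LIMSEQ_le_const[OF L])
    show "Blinfun L \<le> v n" for n
      unfolding less_eq_blinfun_def app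
    proof safe
      fix x :: 'a assume "0 \<le> x"
      then have "blinfun_apply (v m) x \<le> blinfun_apply (v n) x" if "n \<le> m" for m
        using decseqD[OF dec that] by (simp add: less_eq_blinfun_def)
      then show "L x \<le> blinfun_apply (v n) x"
        by (intro LIMSEQ_le_const2[OF L]) auto
    qed
  qed (simp add: app L)
qed

text \<open>
  The rows of \<open>a\<close> tend to zero in each column, so the next index can be taken so large that the
  finitely many columns seen so far become small, even after multiplication by a constant that depends
  on the indices chosen so far.
\<close>
lemma subsequence_small_on_predecessors:
  fixes a :: "nat \<Rightarrow> nat \<Rightarrow> real" and C :: "nat \<Rightarrow> real"
  assumes "\<And>i. (\<lambda>n. a n i) \<longlonglongrightarrow> 0" "0 < d"
  obtains k where "strict_mono k"
    "\<And>n i. i \<le> n \<Longrightarrow> C (k n) * a (k (Suc n)) (k i) \<le> d / 2 ^ n"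
proof -
  have "\<exists>k. \<forall>n. True \<and> (k n < k (Suc n) \<and> (\<forall>i\<le>k n. C (k n) * a (k (Suc n)) i \<le> d / 2 ^ n))"
  proof (rule dependent_nat_choice)
    fix l n
    have "\<forall>\<^sub>F m in sequentially. C l * a m i \<le> d / 2 ^ n" for i
    proof -
      have "(\<lambda>m. C l * a m i) \<longlonglongrightarrow> C l * 0" by (intro tendsto_intros assms)
      moreover have "C l * 0 < d / 2 ^ n" using assms(2) by simp
      ultimately have "\<forall>\<^sub>F m in sequentially. C l * a m i < d / 2 ^ n" by (rule order_tendstoD)
      then show ?thesis by eventually_elim simp
    qed
    then have "\<forall>\<^sub>F m in sequentially. \<forall>i\<in>{..l}. C l * a m i \<le> d / 2 ^ n"
      by (intro eventually_ball_finite) auto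
    from eventually_happens[OF eventually_conj[OF this eventually_gt_at_top[of l]]]
    show "\<exists>m. True \<and> (l < m \<and> (\<forall>i\<le>l. C l * a m i \<le> d / 2 ^ n))" by auto
  qed simp
  then obtain k where k: "\<And>n. k n < k (Suc n)"
    "\<And>n i. i \<le> k n \<Longrightarrow> C (k n) * a (k (Suc n)) i \<le> d / 2 ^ n" by blast
  have sm: "strict_mono k" using k(1) by (simp add: strict_mono_Suc_iff)
  show ?thesis
    using k(2) strict_mono_leD[OF sm] by (intro that[OF sm]) auto
qed

text \<open>
  Along a sparse subsequence \<open>y\<close> of \<open>x\<close>, with functionals \<open>g\<close> taken from \<open>f\<close>, let \<open>v n\<close> be the infimum over \<open>M\<close> of
  the positive parts of \<open>y n - (1 / c n) (\<Sum>i<n. y i) - (\<Sum>m\<in>{n<..M}. c m y m)\<close>. For \<open>n < m\<close>,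
  forming \<open>v n\<close> cuts off \<open>c m y m\<close> from \<open>y n\<close>, and forming \<open>v m\<close> cuts off \<open>(1 / c m) y n\<close> from \<open>y m\<close>,
  which makes the two disjoint. At \<open>g n\<close>, the loss due to earlier terms is at most \<open>e/4\<close>, because \<open>c n\<close> exceeds
  the sum of their norms by the factor \<open>4/e\<close>. The loss due to later terms is at most \<open>e/2\<close>: the
  constant \<open>c m\<close> depends on the indices before the \<open>m\<close>-th only, so that index can be chosen to make
  \<open>c m\<close> times the value of \<open>y m\<close> at \<open>g n\<close> at most \<open>(e/2) / 2^m\<close>.
\<close>
lemma disjointification:
  fixes x :: "nat \<Rightarrow> 'a::banach_lattice \<Rightarrow>\<^sub>L real" and f :: "nat \<Rightarrow> 'a"
  assumes e: "0 < e" and x: "\<And>n. 0 \<le> x n" and f: "\<And>n. 0 \<le> f n" "\<And>n. norm (f n) \<le> 1"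
    and large: "\<And>n. e \<le> blinfun_apply (x n) (f n)"
    and null: "\<And>i. (\<lambda>n. blinfun_apply (x n) (f i)) \<longlonglongrightarrow> 0"
  obtains k v where "strict_mono k" "\<And>n. 0 \<le> v n" "\<And>n. v n \<le> x (k n)" "disjoint_sequence v"
    "\<And>n. e / 4 \<le> blinfun_apply (v n) (f (k n))"
proof -
  define C where "C l = 1 + (4 / e) * (\<Sum>i\<le>l. norm (x i))" for l
  have C1: "1 \<le> C l" for l using e by (simp add: C_def sum_nonneg)
  obtain k where k: "strict_mono k" and small:
    "\<And>n i. i \<le> n \<Longrightarrow> C (k n) * blinfun_apply (x (k (Suc n))) (f (k i)) \<le> (e / 4) / 2 ^ n"
    using subsequence_small_on_predecessors[of "\<lambda>n i. blinfun_apply (x n) (f i)" "e / 4" C] null e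
    by auto
  define y where "y n = x (k n)" for n
  define g where "g n = f (k n)" for n
  \<comment> \<open>For \<open>n = 0\<close> there are no earlier terms, and any value that is at least 1 would do.\<close>
  define c where "c n = C (k (n - 1))" for n
  have y0: "0 \<le> y n" for n by (simp add: y_def x)
  have c1: "1 \<le> c n" for n by (simp add: c_def C1)
  have norm_y: "(\<Sum>i<n. norm (y i)) \<le> c n * (e / 4)" for n
  proof -
    have "(\<Sum>i<n. norm (y i)) = (\<Sum>i\<in>k ` {..<n}. norm (x i))"
      by (simp add: y_def sum.reindex strict_mono_imp_inj_on[OF k] inj_on_subset o_def)
    also have "\<dots> \<le> (\<Sum>i\<le>k (n - 1). norm (x i))"
      using strict_mono_leD[OF k] by (intro sum_mono2) auto
    also have "\<dots> \<le> c n * (e / 4)" using e by (simp add: c_def C_def field_simps)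
    finally show ?thesis .
  qed
  define r where "r n M = y n - (1 / c n) *\<^sub>R (\<Sum>i<n. y i) - (\<Sum>m\<in>{n<..M}. c m *\<^sub>R y m)" for n M
  have cy0: "0 \<le> c m *\<^sub>R y m" for m
    using c1[of m] by (intro scaleR_nonneg_nonneg y0) simp
  have dec: "decseq (\<lambda>M. pprt (r n M))" for n
  proof (rule decseq_SucI, unfold pprt_def, rule sup_mono)
    fix M
    have "(\<Sum>m\<in>{n<..M}. c m *\<^sub>R y m) \<le> (\<Sum>m\<in>{n<..Suc M}. c m *\<^sub>R y m)"
      by (intro sum_mono2 cy0) auto
    then show "r n (Suc M) \<le> r n M" by (simp add: r_def)
  qed simp
  have "\<exists>u. 0 \<le> u \<and> (\<forall>M. u \<le> pprt (r n M)) \<and>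
      (\<lambda>M. blinfun_apply (pprt (r n M)) (g n)) \<longlonglongrightarrow> blinfun_apply u (g n)" for n
    by (rule decseq_functional_limit[OF dec, of n]) (simp, blast)
  then obtain v where v: "\<And>n. 0 \<le> v n" "\<And>n M. v n \<le> pprt (r n M)"
      "\<And>n. (\<lambda>M. blinfun_apply (pprt (r n M)) (g n)) \<longlonglongrightarrow> blinfun_apply (v n) (g n)"
    by metis
  have past0: "0 \<le> (1 / c n) *\<^sub>R (\<Sum>i<n. y i)" for n
    using c1[of n] y0 by (intro scaleR_nonneg_nonneg sum_nonneg) auto
  have fut0: "0 \<le> (\<Sum>m\<in>{n<..M}. c m *\<^sub>R y m)" for n M by (intro sum_nonneg cy0)
  have v_le: "v n \<le> pprt z" if "r n M \<le> z" for n M z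
    using order_trans[OF v(2)[of n M]] that unfolding pprt_def by (meson sup_mono order_refl)
  have "v n \<le> y n" for n
  proof -
    have "r n 0 \<le> y n"
      unfolding r_def using past0[of n] fut0[of n 0] by (simp add: algebra_simps)
    from v_le[OF this] show ?thesis using y0[of n] by (simp add: pprt_def sup_absorb1)
  qed
  moreover have "disjoint_sequence v"
  proof -
    have "inf (v n) (v m) = 0" if "n < m" for n m
    proof (rule inf_pprt_diff_eq_0[OF c1 v(1) _ v(1)])
      have "c m *\<^sub>R y m \<le> (\<Sum>l\<in>{n<..m}. c l *\<^sub>R y l)"
        using that cy0 by (intro member_le_sum_nonneg[of "\<lambda>l. c l *\<^sub>R y l"]) auto
      then have "c m *\<^sub>R y m \<le> (1 / c n) *\<^sub>R (\<Sum>i<n. y i) + (\<Sum>l\<in>{n<..m}. c l *\<^sub>R y l)"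
        using past0[of n] by (rule add_increasing[rotated])
      then show "v n \<le> pprt (y n - c m *\<^sub>R y m)"
        by (intro v_le[of n m]) (simp only: r_def diff_diff_eq diff_left_mono)
      have "y n \<le> (\<Sum>i<m. y i)"
        using that y0 by (intro member_le_sum_nonneg) auto
      then have "(1 / c m) *\<^sub>R y n \<le> (1 / c m) *\<^sub>R (\<Sum>i<m. y i)"
        using c1[of m] by (intro scaleR_left_mono) auto
      then have "(1 / c m) *\<^sub>R y n \<le> (1 / c m) *\<^sub>R (\<Sum>i<m. y i) + (\<Sum>l\<in>{m<..m}. c l *\<^sub>R y l)"
        by simp
      then show "v m \<le> pprt (y m - (1 / c m) *\<^sub>R y n)"
        by (intro v_le[of m m]) (simp only: r_def diff_diff_eq diff_left_mono)
    qed
    then show ?thesis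
      unfolding disjoint_sequence_def using v(1) by (metis abs_of_nonneg inf_commute nat_neq_iff)
  qed
  moreover have "e / 4 \<le> blinfun_apply (v n) (g n)" for n
  proof (rule LIMSEQ_le_const[OF v(3)])
    have past: "(1 / c n) * (\<Sum>i<n. blinfun_apply (y i) (g n)) \<le> e / 4"
    proof -
      have "blinfun_apply (y i) (g n) \<le> norm (y i)" for i
      proof -
        have "blinfun_apply (y i) (g n) \<le> norm (y i) * norm (g n)"
          using norm_blinfun[of "y i" "g n"] by simp
        also have "\<dots> \<le> norm (y i) * 1" unfolding g_def by (intro mult_left_mono f) simp
        finally show ?thesis by simp
      qed
      then have "(\<Sum>i<n. blinfun_apply (y i) (g n)) \<le> c n * (e / 4)"
        by (rule order_trans[OF sum_mono norm_y])
      then show ?thesis using c1[of n] by (simp add: field_simps)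
    qed
    have future: "(\<Sum>m\<in>{n<..M}. c m * blinfun_apply (y m) (g n)) \<le> e / 2" for M
    proof -
      have "(\<Sum>m\<in>{n<..M}. c m * blinfun_apply (y m) (g n)) \<le> (\<Sum>m\<in>{n<..M}. (e / 2) * (1 / 2) ^ m)"
      proof (rule sum_mono)
        fix m assume "m \<in> {n<..M}"
        then obtain j where j: "m = Suc j" "n \<le> j" by (cases m) auto
        show "c m * blinfun_apply (y m) (g n) \<le> (e / 2) * (1 / 2) ^ m"
          using small[OF j(2)] by (simp add: j(1) c_def y_def g_def power_divide field_simps)
      qed
      also have "\<dots> \<le> (\<Sum>m\<in>{1..M}. (e / 2) * (1 / 2) ^ m)"
        using e by (intro sum_mono2) auto
      also have "\<dots> = (e / 2) * (1 - (1 / 2) ^ M)"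
        by (induction M) (simp_all add: field_simps)
      also have "\<dots> \<le> (e / 2) * 1" using e by (intro mult_left_mono) auto
      finally show ?thesis by simp
    qed
    have "e / 4 \<le> blinfun_apply (pprt (r n M)) (g n)" for M
    proof -
      have "e \<le> blinfun_apply (y n) (g n)" using large by (simp add: y_def g_def)
      then have "e / 4 \<le> blinfun_apply (r n M) (g n)"
        using past future[of M]
        by (simp add: r_def blinfun.diff_left blinfun.scaleR_left blinfun.sum_left)
      also have "\<dots> \<le> blinfun_apply (pprt (r n M)) (g n)"
        using f(1) by (simp add: g_def pprt_def flip: less_eq_blinfun_def)
          (metis less_eq_blinfun_def sup_ge1)
      finally show ?thesis .
    qed
    then show "\<exists>N. \<forall>M\<ge>N. e / 4 \<le> blinfun_apply (pprt (r n M)) (g n)" by blast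
  qed
  ultimately show ?thesis using that[OF k, of v] v(1) by (simp add: y_def g_def)
qed


section \<open>Operators into the bounded sequences and the positive Schur property\<close>

lemma positive_operator_of_functionals:
  fixes f :: "nat \<Rightarrow> 'e::banach_lattice \<Rightarrow>\<^sub>L real"
  assumes f: "\<And>n. 0 \<le> f n" "\<And>n. norm (f n) \<le> 1"
  obtains T :: "'e \<Rightarrow> ell_infty" where "positive_operator T"
    "\<And>x n. apply_bcontfun (T x) n = blinfun_apply (f n) x"
proof -
  have bc: "(\<lambda>n. blinfun_apply (f n) x) \<in> bcontfun" for x
  proof (rule bcontfun_normI)
    show "norm (blinfun_apply (f n) x) \<le> norm x" for n
      using norm_blinfun[of "f n" x] f(2)[of n] by (meson mult_left_le_one_le norm_ge_zero order_trans)
  qed simp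
  define T :: "'e \<Rightarrow> ell_infty" where "T x = Bcontfun (\<lambda>n. blinfun_apply (f n) x)" for x
  have T: "apply_bcontfun (T x) n = blinfun_apply (f n) x" for x n
    by (simp add: T_def Bcontfun_inverse[OF bc])
  have "positive_operator T"
    unfolding positive_operator_def
  proof (intro conjI linearI allI impI)
    show "T (x + y) = T x + T y" for x y
      by (rule bcontfun_eqI) (simp add: T blinfun.add_right)
    show "T (r *\<^sub>R x) = r *\<^sub>R T x" for r x
      by (rule bcontfun_eqI) (simp add: T blinfun.scaleR_right)
    show "0 \<le> T x" if "0 \<le> x" for x
      using blinfun_nonneg[OF f(1) that] by (simp add: less_eq_bcontfun_def T)
  qed
  with T show ?thesis using that by blast
qed

text \<open>
  The adjoint of \<open>T\<close> maps the \<open>n\<close>-th coordinate functional, which has norm at most 1, to \<open>f\<close>.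
\<close>
lemma second_adjoint_coordinate_le:
  fixes T :: "'e::banach_lattice \<Rightarrow> ell_infty" and v :: "('e \<Rightarrow>\<^sub>L real) \<Rightarrow>\<^sub>L real"
  assumes T: "bounded_linear T" and coord: "\<And>x. apply_bcontfun (T x) n = blinfun_apply f x"
  shows "blinfun_apply v f \<le> norm (blinfun_apply (second_adjoint (Blinfun T)) v)"
proof -
  have bl: "bounded_linear (\<lambda>s :: ell_infty. apply_bcontfun s n)"
    by (rule bounded_linear_intro[where K = 1]) (use norm_bounded[of "_ :: ell_infty" n] in simp_all)
  define d :: "ell_infty \<Rightarrow>\<^sub>L real" where "d = Blinfun (\<lambda>s. apply_bcontfun s n)"
  have d: "blinfun_apply d s = apply_bcontfun s n" for s
    by (simp add: d_def bounded_linear_Blinfun_apply[OF bl])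
  have norm_d: "norm d \<le> 1"
    by (rule norm_blinfun_bound) (use norm_bounded[of "_ :: ell_infty" n] in \<open>simp_all add: d\<close>)
  have "d o\<^sub>L Blinfun T = f"
    by (rule blinfun_eqI) (simp add: d bounded_linear_Blinfun_apply[OF T] coord)
  then have "blinfun_apply v f = blinfun_apply (blinfun_apply (second_adjoint (Blinfun T)) v) d"
    by (simp add: adjoint_blinfun.rep_eq)
  also have "\<dots> \<le> norm (blinfun_apply (second_adjoint (Blinfun T)) v) * norm d"
    using norm_blinfun[of "blinfun_apply (second_adjoint (Blinfun T)) v" d] by simp
  also have "\<dots> \<le> norm (blinfun_apply (second_adjoint (Blinfun T)) v) * 1"
    by (intro mult_left_mono norm_d) simp
  finally show ?thesis by simp
qed

text \<open>
  Positive and negative parts of a disjoint weakly null sequence are weakly null, hence norm null, so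
  the sequence is norm null even before \<open>S\<close> is applied.
\<close>
lemma positive_schur_imp_almost_dunford_pettis:
  fixes S :: "'a::banach_lattice \<Rightarrow>\<^sub>L 'b::banach"
  assumes schur: "positive_schur_property TYPE('a)"
  shows "almost_dunford_pettis S"
  unfolding almost_dunford_pettis_def
proof (intro allI impI)
  fix x :: "nat \<Rightarrow> 'a"
  assume x: "disjoint_sequence x" "weakly_null x"
  have pprt_null: "(\<lambda>n. pprt (z n)) \<longlonglongrightarrow> 0" if "disjoint_sequence z" "weakly_null z"
    for z :: "nat \<Rightarrow> 'a"
    using schur weakly_null_pprt_of_disjoint[OF that] by (simp add: positive_schur_property_def)
  have "disjoint_sequence (\<lambda>n. - x n)" "weakly_null (\<lambda>n. - x n)"
    using x(1) x(2)[unfolded weakly_null_def, THEN spec, THEN tendsto_minus]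
    by (simp_all add: disjoint_sequence_def weakly_null_def blinfun.minus_right)
  from tendsto_diff[OF pprt_null[OF x] pprt_null[OF this]]
  have "(\<lambda>n. pprt (x n) - pprt (- x n)) \<longlonglongrightarrow> 0" by simp
  moreover have "pprt (x n) - pprt (- x n) = x n" for n
    using prts[of "x n"] by (simp add: pprt_neg)
  ultimately have "x \<longlonglongrightarrow> 0" by simp
  then show "(\<lambda>n. blinfun_apply S (x n)) \<longlonglongrightarrow> 0"
    using blinfun.tendsto[OF tendsto_const, of x 0 _ S] by (simp add: blinfun.zero_right)
qed

text \<open>
  A single operator defeats a given bad sequence: its coordinates are the functionals at which the
  disjointified sequence stays large.
\<close>
lemma bidual_positive_schur_of_operators:
  assumes adp: "\<And>T :: 'e::banach_lattice \<Rightarrow> ell_infty.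
      positive_operator T \<Longrightarrow> almost_dunford_pettis (second_adjoint (Blinfun T))"
  shows "positive_schur_property TYPE(('e \<Rightarrow>\<^sub>L real) \<Rightarrow>\<^sub>L real)"
  unfolding positive_schur_property_def
proof (intro allI impI, rule ccontr)
  fix x :: "nat \<Rightarrow> ('e \<Rightarrow>\<^sub>L real) \<Rightarrow>\<^sub>L real"
  assume x: "\<forall>n. 0 \<le> x n" "weakly_null x" and not_null: "\<not> x \<longlonglongrightarrow> 0"
  from not_null obtain e where e: "0 < e" "\<And>N. \<exists>n\<ge>N. e \<le> norm (x n)"
    unfolding LIMSEQ_iff diff_zero by (meson not_less)
  have "infinite {n. e \<le> norm (x n)}"
    unfolding infinite_nat_iff_unbounded_le using e(2) by blast
  from infinite_enumerate[OF this]
  obtain s :: "nat \<Rightarrow> nat" where s: "strict_mono s" "\<And>n. e \<le> norm (x (s n))"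
    by blast
  define z where "z = x \<circ> s"
  have z: "\<And>n. 0 \<le> z n" "weakly_null z" "\<And>n. e \<le> norm (z n)"
    using x s weakly_null_subseq[OF x(2) s(1)] by (auto simp: z_def)
  have "\<exists>f. 0 \<le> f \<and> norm f \<le> 1 \<and> e / 2 \<le> blinfun_apply (z n) f" for n
  proof -
    have "e / 2 < norm (z n)" "0 \<le> e / 2" using z(3)[of n] e(1) by linarith+
    from blinfun_almost_norming_nonneg[OF z(1) this] show ?thesis by blast
  qed
  then obtain f where f: "\<And>n. 0 \<le> f n" "\<And>n. norm (f n) \<le> 1"
      "\<And>n. e / 2 \<le> blinfun_apply (z n) (f n)"
    by metis
  have "(\<lambda>n. blinfun_apply (z n) (f i)) \<longlonglongrightarrow> 0" for i
  proof -
    have "bounded_linear (\<lambda>\<phi> :: ('e \<Rightarrow>\<^sub>L real) \<Rightarrow>\<^sub>L real. blinfun_apply \<phi> (f i))"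
      by (rule blinfun.bounded_linear_left)
    then show ?thesis
      using z(2)[unfolded weakly_null_def, THEN spec, of "Blinfun (\<lambda>\<phi>. blinfun_apply \<phi> (f i))"]
      by (simp add: bounded_linear_Blinfun_apply)
  qed
  moreover have "0 < e / 2" using e(1) by simp
  ultimately obtain k v where k: "strict_mono k" and v: "\<And>n. 0 \<le> v n" "\<And>n. v n \<le> z (k n)"
      "disjoint_sequence v" "\<And>n. (e / 2) / 4 \<le> blinfun_apply (v n) (f (k n))"
    using disjointification[of "e / 2" z f, OF _ z(1) f] by blast
  have "weakly_null v"
    using weakly_null_le[OF weakly_null_subseq[OF z(2) k] v(1)] v(2) by simp
  obtain T :: "'e \<Rightarrow> ell_infty" where T: "positive_operator T"
      "\<And>y n. apply_bcontfun (T y) n = blinfun_apply (f (k n)) y"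
    by (rule positive_operator_of_functionals[of "\<lambda>n. f (k n)", OF f(1,2)]) (rule that)
  have "(\<lambda>n. blinfun_apply (second_adjoint (Blinfun T)) (v n)) \<longlonglongrightarrow> 0"
    using adp[OF T(1), unfolded almost_dunford_pettis_def, rule_format] v(3) \<open>weakly_null v\<close> .
  then have "(\<lambda>n. norm (blinfun_apply (second_adjoint (Blinfun T)) (v n))) \<longlonglongrightarrow> 0"
    by (rule tendsto_norm_zero)
  moreover have "e / 8 \<le> norm (blinfun_apply (second_adjoint (Blinfun T)) (v n))" for n
  proof -
    have "(e / 2) / 4 \<le> blinfun_apply (v n) (f (k n))" by (rule v(4))
    also have "\<dots> \<le> norm (blinfun_apply (second_adjoint (Blinfun T)) (v n))"
      by (rule second_adjoint_coordinate_le[OF positive_operator_bounded_linear[OF T(1)] T(2)])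
    finally show ?thesis by simp
  qed
  then have "\<exists>N. \<forall>n\<ge>N. e / 8 \<le> norm (blinfun_apply (second_adjoint (Blinfun T)) (v n))"
    by blast
  ultimately have "e / 8 \<le> 0" by (rule LIMSEQ_le_const)
  with e(1) show False by simp
qed

theorem theorem2p1:
  defines "a \<equiv> \<forall>T :: 'e::banach_lattice \<Rightarrow> ell_infty.
      bounded_linear T \<longrightarrow> almost_dunford_pettis (second_adjoint (Blinfun T))"
    and "b \<equiv> \<forall>T :: 'e \<Rightarrow> ell_infty.
      regular_operator T \<longrightarrow> almost_dunford_pettis (second_adjoint (Blinfun T))"
    and "c \<equiv> \<forall>T :: 'e \<Rightarrow> ell_infty.
      positive_operator T \<longrightarrow> almost_dunford_pettis (second_adjoint (Blinfun T))"
    and "d \<equiv> positive_schur_property TYPE(('e \<Rightarrow>\<^sub>L real) \<Rightarrow>\<^sub>L real)"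
  shows "(a \<longleftrightarrow> b) \<and> (b \<longleftrightarrow> c) \<and> (c \<longleftrightarrow> d)"
proof -
  have "a \<Longrightarrow> b"
    unfolding a_def b_def by (blast dest: regular_operator_bounded_linear)
  moreover have "b \<Longrightarrow> c"
  proof -
    have "regular_operator T" if "positive_operator T" for T :: "'e \<Rightarrow> ell_infty"
      unfolding regular_operator_def using that
      by (intro exI[of _ T] exI[of _ "\<lambda>_. 0"]) (simp add: positive_operator_def linear_zero)
    then show "b \<Longrightarrow> c" unfolding b_def c_def by blast
  qed
  moreover have "c \<Longrightarrow> d"
    unfolding c_def d_def by (blast intro: bidual_positive_schur_of_operators)
  moreover have "d \<Longrightarrow> a"
    unfolding a_def d_def by (blast intro: positive_schur_imp_almost_dunford_pettis)
  ultimately show ?thesis by blast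
qed

end
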